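(* Assume the following. (1) (Within-cluster variation) $\|\xi_i\|_2\le\varepsilon_c$ for all $i\in[n]$, for a constant $\varepsilon_c\ge 0$. (2) (Outlier rate) $\max_{k\in[K]}\frac{|\mathcal O\cap\Lambda_k|}{n_k}\le\rho$ for a constant $\rho>0$. (3) (Outlier magnitude) $\|o_i\|_2\le\varepsilon_o$ for all $i\in\mathcal O$, for a constant $\varepsilon_o\ge0$, and $\varepsilon_c+\rho\varepsilon_o>0$. (4) (Cluster-center Jacobian) There are constants $\alpha_c,\beta_c,L_c>0$ such that for every $W\in\mathcal D(W_0,R_{\mathrm{loc}})$ and every unit vector $z\in\mathbb R^{Kp}$, $\alpha_c\le\|J_c(W)^\top z\|_2\le\beta_c$, and for all $W_1,W_2\in\mathcal D(W_0,R_{\mathrm{loc}})$, $\|J_c(W_1)-J_c(W_2)\|\le L_c\|W_1-W_2\|_F$. (5) (Radius condition) $R_{\mathrm{loc}}\ge\frac{2\beta}{\alpha^2}\widehat R_0$. (6) (Activation bounds) $\phi$ is twice differentiable with $|\phi'(t)|\le B_1$ and $|\phi''(t)|\le B_2$ for all $t\in\mathbb R$. (7) (Step size) $0<\eta\le\min\left\{\frac{\alpha^2}{8\beta^4},\frac{\alpha^2}{2L\beta^2\widehat R_0}\right\}$. Fix an integer $T\ge T_\star(\varepsilon_c+\rho\varepsilon_o)$. If $$\Delta_{\mathrm{path}}(T)\le R_{\mathrm{loc}}-\frac{2\beta}{\alpha^2}\widehat R_0\quad\text{and}\quad \delta:=\min_{a\ne b}\|\mu_a-\mu_b\|_2>2\zeta_T+4(\varepsilon_c+\rho\varepsilon_o),$$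 then $$\|\mathcal F_{W_T}(X)-\widetilde X\|_{2,\infty}\le\zeta_T+2(\varepsilon_c+\rho\varepsilon_o),$$ equivalently, $\|F_{W_T}(x_i)-\mu_{g(i)}\|_2\le\zeta_T+2(\varepsilon_c+\rho\varepsilon_o)$ for all $i\in[n]$. Consequently, $\arg\min_{1\le k\le K}\|F_{W_T}(x_i)-\mu_k\|_2=g(i)$ for all $i\in[n]$ (i.e. $k=g(i)$ is the unique minimizer).
   Context: Data. $n,p,H,K$ are positive integers, $[N]=\{1,\dots,N\}$. Given cluster centers $\mu_1,\dots,\mu_K\in\mathbb R^p$ and a cluster-assignment map $g:[n]\to[K]$, put $\Lambda_k=\{i\in[n]:g(i)=k\}$, $n_k=|\Lambda_k|\ge1$, $n_{\min}=\min_kn_k$, $n_{\max}=\max_kn_k$. The samples are $x_i=\widetilde x_i+\xi_i+o_i\in\mathbb R^p$ with $\widetilde x_i=\mu_{g(i)}$ and $\xi_i,o_i\in\mathbb R^p$. $\mathcal O=\{i\in[n]:o_i\ne0\}$ is the set of outliers; indices not in $\mathcal O$ are inliers. $X=(x_1^\top,\dots,x_n^\top)^\top$ and $\widetilde X=(\widetilde x_1^\top,\dots,\widetilde x_n^\top)^\top$ in $\mathbb R^{np}$. Norms. For $v=(v_1^\top,\dots,v_n^\top)^\top\in\mathbb R^{np}$ with blocks $v_i\in\mathbb R^p$: $\|v\|_2=(\sum_i\|v_i\|_2^2)^{1/2}$, $\|v\|_{2,\infty}=\max_i\|v_i\|_2$. For matrices, $\|\cdot\|$ is the operator norm and $\|\cdot\|_F$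 the Frobenius norm. Model. $F_W(x)=A\phi(Wx)$ for $W\in\mathbb R^{H\times p}$ (trainable), where $A\in\mathbb R^{p\times H}$ is fixed and $\phi:\mathbb R\to\mathbb R$ is applied entrywise. $w=\mathrm{vec}(W)\in\mathbb R^{Hp}$ stacks the columns of $W$; $\mathrm{mat}$ is its inverse. $\mathcal F_W(X)=(F_W(x_1)^\top,\dots,F_W(x_n)^\top)^\top\in\mathbb R^{np}$, similarly $\mathcal F_W(\widetilde X)$ with $\widetilde x_i$ in place of $x_i$, and $\mathcal F_W(\mu)=(F_W(\mu_1)^\top,\dots,F_W(\mu_K)^\top)^\top\in\mathbb R^{Kp}$. $J(W)=\partial\mathcal F_W(X)/\partial w$ and $J_c(W)=\partial\mathcal F_W(\mu)/\partial w\in\mathbb R^{Kp\times Hp}$ are Jacobians with respect to $w$. An initialization $W_0\in\mathbb R^{H\times p}$ and a radius $R_{\mathrm{loc}}>0$ are fixed; $\mathcal D(W_0,R_{\mathrm{loc}})=\{W\in\mathbb R^{H\times p}:\|W-W_0\|_F\le R_{\mathrm{loc}}\}$. Gradient descent. $(W_\tau)_{\tau\ge0}$ starts at $W_0$ and satisfies $w_{\tau+1}=w_\tau-\eta J(W_\tau)^\top r_\tau$, $r_\tau=\mathcal F_{W_\tau}(X)-X$, $W_\tau=\mathrm{mat}(w_\tau)$; this is gradient descent with learning rate $\eta$ on $\frac12\|\mathcal F_W(X)-X\|_2^2$. Constants. $\alpha=\sqrt{n_{\min}}\,\alpha_c$, $\beta=\sqrt{n_{\max}}\,\beta_c$, $L=\sqrt{n_{\max}}\,L_c$;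 $\widetilde R_0=\|\mathcal F_{W_0}(\widetilde X)-\widetilde X\|_2$; $\widehat R_0=\widetilde R_0+\sqrt n\,\varepsilon_c+\sqrt{\rho n}\,\varepsilon_o$; for $\nu>0$, $T_\star(\nu)=\left\lceil\frac{2}{\eta\alpha^2}\log_+\left(\frac{\widehat R_0}{\nu}\right)\right\rceil$ with $\log_+t=\max\{\log t,0\}$; $R_\mu=\max_k\|\mu_k\|_2$; $R_W=\|W_0\|_F+R_{\mathrm{loc}}$; $\Delta_f=\|A\|B_1R_W(\varepsilon_c+\varepsilon_o)$; $\Delta_J=\sqrt n\,\|A\|(B_1+B_2R_WR_\mu)(\varepsilon_c+\varepsilon_o)$; $\beta_X=\beta+\Delta_J$; $\kappa=L\widehat R_0+\beta\beta_X$; $\gamma=\Delta_J\widehat R_0+\beta_X\sqrt n\,\Delta_f$; for integers $T\ge0$, $\Delta_{\mathrm{path}}(T)=\eta\gamma T\exp(\eta\kappa T)$ and $\zeta_T=\Delta_f+\beta\Delta_{\mathrm{path}}(T)$. *)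

theory Defs
  imports "HOL-Analysis.Analysis"
begin

(* Finite types index samples, coordinates, hidden units and clusters; concatenated block
   vectors are indexed by pairs (block, coordinate).  The library norm on "real ^ 'a" is
   the Euclidean norm, and the library norm on "real ^ 'a ^ 'b" is the Frobenius norm. *)

abbreviation op_norm :: "real ^ 'a::finite ^ 'b::finite \<Rightarrow> real" where
  "op_norm M \<equiv> onorm ((*v) M)"

definition stack :: "('n::finite \<Rightarrow> real ^ 'p::finite) \<Rightarrow> real ^ ('n \<times> 'p)" where
  "stack v = (\<chi> q. v (fst q) $ snd q)"

definition block :: "real ^ ('n::finite \<times> 'p::finite) \<Rightarrow> 'n \<Rightarrow> real ^ 'p" where
  "block v i = (\<chi> j. v $ (i, j))"

definition norm_2inf :: "real ^ ('n::finite \<times> 'p::finite) \<Rightarrow> real" where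
  "norm_2inf v = Max (range (\<lambda>i. norm (block v i)))"

(* Columns are the blocks of the vectorization: entry (j, h) is the entry of W in row h
   and column j. *)
definition mat_to_vec :: "real ^ 'p::finite ^ 'h::finite \<Rightarrow> real ^ ('p \<times> 'h)" where
  "mat_to_vec W = (\<chi> q. W $ snd q $ fst q)"

definition vec_to_mat :: "real ^ ('p::finite \<times> 'h::finite) \<Rightarrow> real ^ 'p ^ 'h" where
  "vec_to_mat w = (\<chi> h j. w $ (j, h))"

definition net :: "real ^ 'h::finite ^ 'p::finite \<Rightarrow> (real \<Rightarrow> real) \<Rightarrow> real ^ 'p ^ 'h \<Rightarrow> real ^ 'p \<Rightarrow> real ^ 'p" where
  "net A \<phi> W x = A *v (\<chi> h. \<phi> ((W *v x) $ h))"

definition net_stack ::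
  "real ^ 'h::finite ^ 'p::finite \<Rightarrow> (real \<Rightarrow> real) \<Rightarrow> real ^ 'p ^ 'h \<Rightarrow> ('n::finite \<Rightarrow> real ^ 'p) \<Rightarrow> real ^ ('n \<times> 'p)" where
  "net_stack A \<phi> W x = stack (\<lambda>i. net A \<phi> W (x i))"

definition net_jacobian ::
  "real ^ 'h::finite ^ 'p::finite \<Rightarrow> (real \<Rightarrow> real) \<Rightarrow> ('n::finite \<Rightarrow> real ^ 'p) \<Rightarrow> real ^ 'p ^ 'h
    \<Rightarrow> real ^ ('p \<times> 'h) ^ ('n \<times> 'p)" where
  "net_jacobian A \<phi> x W =
     matrix (frechet_derivative (\<lambda>w. net_stack A \<phi> (vec_to_mat w) x) (at (mat_to_vec W)))"

(* Since ln 0 = 0 in HOL, the value at 0 is 0, as for the convention log 0 = -infinity. *)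
definition log_plus :: "real \<Rightarrow> real" where
  "log_plus t = max (ln t) 0"

end

theory Submission
  imports Defs
begin

text \<open>
  The iterates are compared with a reference gradient descent that uses the targets \<open>X\<close> but the
  clean inputs. Its Jacobian maps into the cluster-constant vectors, so the residual against \<open>X\<close>
  splits orthogonally: the part against the cluster means of \<open>X\<close> contracts by
  \<open>1 - \<eta> \<alpha>\<^sup>2 / 2\<close> per step, and the rest is constant and invisible to the gradient. After
  \<open>T\<close> steps the reference fits each cluster mean up to \<open>\<epsilon>c + \<rho> \<epsilon>o\<close>, and that mean is itself
  within \<open>\<epsilon>c + \<rho> \<epsilon>o\<close> of the cluster center. Perturbing the inputs changes the gradient by at
  most \<open>\<gamma> + \<kappa> d\<close> when the two paths are at distance \<open>d\<close>, so a discrete Gronwall argument keeps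
  them within \<open>\<Delta>path T\<close> of each other.
\<close>

section \<open>Gradient descent for nonlinear least squares\<close>

text \<open>Pairing the transposed product with itself and moving the transpose across the inner
  product leaves only Cauchy-Schwarz. This carries bounds both ways between a Jacobian and the
  transpose that occurs in gradients.\<close>

lemma norm_transpose_mult_le:
  fixes M :: "real ^ 'a ^ 'b"
  assumes "\<And>h. norm (M *v h) \<le> C * norm h"
  shows "norm (transpose M *v z) \<le> C * norm z"
proof (cases "transpose M *v z = 0")
  case True
  \<comment> \<open>The sign of \<open>C\<close> is not assumed; the hypothesis at a unit coordinate
    vector forces it to be nonnegative.\<close>
  have "0 \<le> C * norm (axis undefined 1 :: real ^ 'a)"
    using assms[of "axis undefined 1"] norm_ge_zero order_trans by blast
  then show ?thesis using True by simp
next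
  case False
  let ?v = "transpose M *v z"
  have "norm ?v * norm ?v = ?v \<bullet> ?v"
    by (simp flip: power2_norm_eq_inner power2_eq_square)
  also have "\<dots> = z \<bullet> (M *v ?v)"
    by (metis dot_lmul_matrix transpose_matrix_vector)
  also have "\<dots> \<le> norm z * (C * norm ?v)"
    by (meson assms mult_left_mono norm_cauchy_schwarz norm_ge_zero order_trans)
  finally have "norm ?v * norm ?v \<le> (C * norm z) * norm ?v" by (simp add: mult.commute mult.left_commute)
  then show ?thesis using False by simp
qed

text \<open>
  The factor 1/2 matters: with the cruder mean value bound the step-size condition does not give
  the rate in the contraction lemma below.
\<close>

lemma first_order_remainder_le:
  fixes f :: "'a::real_normed_vector \<Rightarrow> 'b::real_normed_vector"
  assumes der: "\<And>v. (f has_derivative f' v) (at v)"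
    and S: "convex S" "x \<in> S" "y \<in> S"
    and lip: "\<And>v h. v \<in> S \<Longrightarrow> norm (f' v h - f' x h) \<le> C * norm (v - x) * norm h"
  shows "norm (f y - f x - f' x (y - x)) \<le> C / 2 * norm (y - x) ^ 2"
proof -
  define d where "d = y - x"
  \<comment> \<open>\<open>F\<close> drops the linear part, so its derivative along the segment is a
    difference of derivatives of \<open>f\<close>, which grows at most linearly in \<open>t\<close>.
    \<open>G\<close> is the primitive of that bound; integrating \<open>t\<close> gives the factor
    1/2.\<close>
  define F where "F = (\<lambda>t::real. f (x + t *\<^sub>R d) - t *\<^sub>R f' x d)"
  define G where "G = (\<lambda>t::real. C / 2 * norm d ^ 2 * t ^ 2)"
  have F': "(F has_vector_derivative (f' (x + t *\<^sub>R d) d - f' x d)) (at t)" for t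
  proof -
    have "((\<lambda>t. x + t *\<^sub>R d) has_derivative (\<lambda>s. s *\<^sub>R d)) (at t)"
      by (auto intro!: derivative_eq_intros)
    from has_derivative_compose[OF this der]
    have "((\<lambda>t. f (x + t *\<^sub>R d)) has_derivative (\<lambda>s. f' (x + t *\<^sub>R d) (s *\<^sub>R d))) (at t)" .
    moreover have "f' (x + t *\<^sub>R d) (s *\<^sub>R d) = s *\<^sub>R f' (x + t *\<^sub>R d) d" for s
      using has_derivative_linear[OF der] linear_cmul by blast
    ultimately have "((\<lambda>t. f (x + t *\<^sub>R d)) has_vector_derivative f' (x + t *\<^sub>R d) d) (at t)"
      by (simp add: has_vector_derivative_def)
    then show ?thesis
      unfolding F_def by (auto intro!: derivative_eq_intros)
  qed
  have G': "(G has_vector_derivative (C * norm d ^ 2 * t)) (at t)" for t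
    unfolding G_def has_real_derivative_iff_has_vector_derivative[symmetric]
    by (auto intro!: derivative_eq_intros)
  have "norm (F 1 - F 0) \<le> G 1 - G 0"
  proof (rule differentiable_bound_general[of 0 1 F G])
    show "continuous_on {0..1} F"
      by (meson F' continuous_at_imp_continuous_on has_vector_derivative_continuous)
    show "continuous_on {0..1} G"
      by (meson G' continuous_at_imp_continuous_on has_vector_derivative_continuous)
    fix t :: real assume t: "0 < t" "t < 1"
    show "(F has_vector_derivative (f' (x + t *\<^sub>R d) d - f' x d)) (at t)" by (rule F')
    show "(G has_vector_derivative (C * norm d ^ 2 * t)) (at t)" by (rule G')
    have "x + t *\<^sub>R d = (1 - t) *\<^sub>R x + t *\<^sub>R y" by (simp add: d_def algebra_simps)
    then have "x + t *\<^sub>R d \<in> S" using convexD_alt[OF S(1,2,3), of t] t by simp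
    from lip[OF this, of d] t show "norm (f' (x + t *\<^sub>R d) d - f' x d) \<le> C * norm d ^ 2 * t"
      by (simp add: power2_eq_square mult.assoc mult.commute mult.left_commute)
  qed simp
  moreover have "F 1 - F 0 = f y - f x - f' x (y - x)" by (simp add: F_def d_def)
  ultimately show ?thesis by (simp add: G_def d_def)
qed

text \<open>Dimensionless form of the step-size condition: as \<alpha> \<le> \<beta>, a factor
  \<open>\<beta> ^ 2\<close> cancels.\<close>

lemma step_size_le:
  fixes \<eta> \<alpha> \<beta> :: real
  assumes "0 \<le> \<eta>" "0 < \<alpha>" "\<alpha> \<le> \<beta>" and step: "8 * \<eta> * \<beta> ^ 4 \<le> \<alpha> ^ 2"
  shows "8 * (\<eta> * \<beta> ^ 2) \<le> 1" and "\<eta> * \<alpha> ^ 2 \<le> \<eta> * \<beta> ^ 2"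
proof -
  have a2: "\<alpha> ^ 2 \<le> \<beta> ^ 2" "0 < \<beta> ^ 2" using assms by (auto intro: power_mono)
  have "8 * (\<eta> * \<beta> ^ 2) * \<beta> ^ 2 \<le> 1 * \<beta> ^ 2"
    using step a2 by (simp add: power2_eq_square power4_eq_xxxx mult.assoc)
  then show "8 * (\<eta> * \<beta> ^ 2) \<le> 1"
    by (rule mult_right_le_imp_le) (rule a2(2))
  show "\<eta> * \<alpha> ^ 2 \<le> \<eta> * \<beta> ^ 2" using a2 assms by (simp add: mult_left_mono)
qed

text \<open>The linearized step shrinks the residual by
  \<open>1 - 15/16 * (\<eta> * \<alpha> ^ 2)\<close>, and the quadratic remainder gives back at most
  a quarter of \<open>\<eta> * \<alpha> ^ 2\<close>. The lower bound \<open>pl\<close> is asked only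
  at the current residual: the Jacobian for clustered inputs has a nontrivial left kernel as soon as
  two samples share a cluster, so a bound on all vectors would fail.\<close>

lemma gradient_step_contraction:
  fixes f :: "real ^ 'a \<Rightarrow> real ^ 'b" and J :: "real ^ 'a \<Rightarrow> real ^ 'a ^ 'b" and y :: "real ^ 'b"
  defines "G \<equiv> \<lambda>w. transpose (J w) *v (f w - y)"
  assumes der: "\<And>w. (f has_derivative (*v) (J w)) (at w)"
    and S: "convex S" "w \<in> S" "w - \<eta> *\<^sub>R G w \<in> S"
    and pl: "\<alpha> * norm (f w - y) \<le> norm (G w)"
    and upper: "\<And>h. norm (J w *v h) \<le> \<beta> * norm h"
    and lip: "\<And>v h. v \<in> S \<Longrightarrow> norm (J v *v h - J w *v h) \<le> L * norm (v - w) * norm h"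
    and R0: "norm (f w - y) \<le> R0"
    and pos: "0 < \<alpha>" "\<alpha> \<le> \<beta>" "0 \<le> L" "0 \<le> \<eta>"
    and step: "8 * \<eta> * \<beta> ^ 4 \<le> \<alpha> ^ 2" "2 * \<eta> * L * \<beta> ^ 2 * R0 \<le> \<alpha> ^ 2"
  shows "norm (f (w - \<eta> *\<^sub>R G w) - y) \<le> (1 - \<eta> * \<alpha> ^ 2 / 2) * norm (f w - y)"
proof -
  let ?w = "w - \<eta> *\<^sub>R G w"
  define r where "r = f w - y"
  define d where "d = J w *v G w"
  note eb = step_size_le(1)[OF pos(4,1,2) step(1)] and ea = step_size_le(2)[OF pos(4,1,2) step(1)]
  have e: "norm (f ?w - y - (r - \<eta> *\<^sub>R d)) \<le> L / 2 * (\<eta> * norm (G w)) ^ 2"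
  proof -
    have dw: "?w - w = (- \<eta>) *\<^sub>R G w" by simp
    have Jdw: "J w *v ((- \<eta>) *\<^sub>R G w) = (- \<eta>) *\<^sub>R d"
      unfolding d_def by (rule matrix_vector_mult_scaleR)
    have "norm (f ?w - f w - (- \<eta>) *\<^sub>R d) \<le> L / 2 * norm ((- \<eta>) *\<^sub>R G w) ^ 2"
      using first_order_remainder_le[OF der S lip] unfolding dw Jdw .
    then have "norm (f ?w - f w - (- \<eta>) *\<^sub>R d) \<le> L / 2 * (\<eta> * norm (G w)) ^ 2"
      using pos by simp
    moreover have "f ?w - f w - (- \<eta>) *\<^sub>R d = f ?w - y - (r - \<eta> *\<^sub>R d)"
      by (simp add: r_def)
    ultimately show ?thesis by (simp only:)
  qed
  have gu: "norm (G w) \<le> \<beta> * norm r"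
    unfolding G_def r_def by (rule norm_transpose_mult_le) (rule upper)
  have gl: "\<alpha> * norm r \<le> norm (G w)" using pl by (simp add: r_def)
  have gsq: "\<alpha> ^ 2 * norm r ^ 2 \<le> norm (G w) ^ 2" "norm (G w) ^ 2 \<le> \<beta> ^ 2 * norm r ^ 2"
    using power_mono[OF gl, of 2] power_mono[OF gu, of 2] pos by (simp_all add: power_mult_distrib)
  \<comment> \<open>Here \<open>d\<close> is the Jacobian times its transpose applied to
    \<open>r\<close>.\<close>
  have "r \<bullet> d = norm (G w) ^ 2"
    unfolding d_def G_def r_def power2_norm_eq_inner
    by (metis dot_lmul_matrix transpose_matrix_vector)
  then have "norm (r - \<eta> *\<^sub>R d) ^ 2 = norm r ^ 2 - 2 * \<eta> * norm (G w) ^ 2 + \<eta> ^ 2 * norm d ^ 2"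
    unfolding power2_norm_eq_inner
    by (simp add: inner_diff_left inner_diff_right inner_commute power2_eq_square algebra_simps)
  also have "\<dots> \<le> norm r ^ 2 - 2 * \<eta> * norm (G w) ^ 2 + \<eta> ^ 2 * (\<beta> ^ 2 * norm (G w) ^ 2)"
    using power_mono[OF upper[of "G w"], of 2] by (simp add: d_def power_mult_distrib mult_left_mono)
  also have "\<dots> = norm r ^ 2 - \<eta> * (2 - \<eta> * \<beta> ^ 2) * norm (G w) ^ 2"
    by (simp add: power2_eq_square algebra_simps)
  \<comment> \<open>From \<open>\<eta> * \<beta> ^ 2\<close> at most 1/8, the factor
    \<open>2 - \<eta> * \<beta> ^ 2\<close> is at least 15/8. Completing the square afterwards
    allows the square root to be taken.\<close>
  also have "\<dots> \<le> norm r ^ 2 - \<eta> * (15 / 8) * (\<alpha> ^ 2 * norm r ^ 2)"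
    using eb pos gsq by (intro diff_left_mono mult_mono) auto
  also have "\<dots> = ((1 - 15 / 16 * (\<eta> * \<alpha> ^ 2)) * norm r) ^ 2 - (15 / 16 * (\<eta> * \<alpha> ^ 2) * norm r) ^ 2"
    by (simp add: power2_eq_square algebra_simps)
  also have "\<dots> \<le> ((1 - 15 / 16 * (\<eta> * \<alpha> ^ 2)) * norm r) ^ 2"
    by simp
  finally have "norm (r - \<eta> *\<^sub>R d) \<le> (1 - 15 / 16 * (\<eta> * \<alpha> ^ 2)) * norm r"
    by (rule power2_le_imp_le) (use ea eb in \<open>auto intro!: mult_nonneg_nonneg\<close>)
  \<comment> \<open>One factor \<open>norm r\<close> is replaced by \<open>R0\<close>, so that the
    second step-size condition absorbs the curvature \<open>L\<close>.\<close>
  moreover have "L / 2 * (\<eta> * norm (G w)) ^ 2 \<le> \<eta> * \<alpha> ^ 2 / 4 * norm r"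
  proof -
    have "L / 2 * (\<eta> * norm (G w)) ^ 2 \<le> L / 2 * (\<eta> ^ 2 * (\<beta> ^ 2 * norm r ^ 2))"
      using gsq pos by (simp add: power_mult_distrib mult_left_mono)
    also have "\<dots> = \<eta> / 4 * norm r * (2 * \<eta> * L * \<beta> ^ 2 * norm r)"
      by (simp add: power2_eq_square)
    also have "\<dots> \<le> \<eta> / 4 * norm r * (2 * \<eta> * L * \<beta> ^ 2 * R0)"
      using R0 pos by (intro mult_left_mono) (auto simp: r_def)
    also have "\<dots> \<le> \<eta> / 4 * norm r * \<alpha> ^ 2"
      using step(2) pos by (intro mult_left_mono) auto
    finally show ?thesis by (simp add: mult_ac)
  qed
  moreover have "norm (f ?w - y) \<le> norm (r - \<eta> *\<^sub>R d) + norm (f ?w - y - (r - \<eta> *\<^sub>R d))"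
    by (rule norm_triangle_sub)
  ultimately have "norm (f ?w - y) \<le> (1 - 15 / 16 * (\<eta> * \<alpha> ^ 2)) * norm r + \<eta> * \<alpha> ^ 2 / 4 * norm r"
    using e by linarith
  \<comment> \<open>15/16 less 1/4 is 11/16, still above the claimed 1/2.\<close>
  also have "\<dots> = (1 - 11 / 16 * (\<eta> * \<alpha> ^ 2)) * norm r" by (simp add: algebra_simps)
  also have "\<dots> \<le> (1 - \<eta> * \<alpha> ^ 2 / 2) * norm r"
    using pos by (intro mult_right_mono) auto
  finally show ?thesis by (simp add: r_def)
qed

text \<open>Decay and confinement to the ball are proved together: geometric decay of the residual
  makes the step lengths summable, with total \<open>2 * \<beta> / \<alpha> ^ 2 * R0\<close>, and
  staying in the ball keeps the hypotheses available for the next step.\<close>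

lemma gradient_descent_linear_convergence:
  fixes f :: "real ^ 'a \<Rightarrow> real ^ 'b" and J :: "real ^ 'a \<Rightarrow> real ^ 'a ^ 'b" and y :: "real ^ 'b"
  assumes der: "\<And>w. (f has_derivative (*v) (J w)) (at w)"
    and pl: "\<And>w. w \<in> cball w0 R \<Longrightarrow> \<alpha> * norm (f w - y) \<le> norm (transpose (J w) *v (f w - y))"
    and upper: "\<And>w h. w \<in> cball w0 R \<Longrightarrow> norm (J w *v h) \<le> \<beta> * norm h"
    and lip: "\<And>v w h. v \<in> cball w0 R \<Longrightarrow> w \<in> cball w0 R \<Longrightarrow>
      norm (J v *v h - J w *v h) \<le> L * norm (v - w) * norm h"
    and R0: "norm (f w0 - y) \<le> R0"
    and pos: "0 < \<alpha>" "\<alpha> \<le> \<beta>" "0 \<le> L" "0 \<le> \<eta>"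
    and step: "8 * \<eta> * \<beta> ^ 4 \<le> \<alpha> ^ 2" "2 * \<eta> * L * \<beta> ^ 2 * R0 \<le> \<alpha> ^ 2"
    and radius: "2 * \<beta> / \<alpha> ^ 2 * R0 \<le> R"
    and u: "u 0 = w0" "\<And>\<tau>. u (Suc \<tau>) = u \<tau> - \<eta> *\<^sub>R (transpose (J (u \<tau>)) *v (f (u \<tau>) - y))"
  shows "norm (f (u \<tau>) - y) \<le> (1 - \<eta> * \<alpha> ^ 2 / 2) ^ \<tau> * norm (f w0 - y)"
    and "norm (u \<tau> - w0) \<le> 2 * \<beta> / \<alpha> ^ 2 * R0"
proof -
  define q where "q = 1 - \<eta> * \<alpha> ^ 2 / 2"
  define C where "C = 2 * \<beta> / \<alpha> ^ 2 * R0"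
  have R0pos: "0 \<le> R0" using R0 norm_ge_zero order_trans by blast
  have Cpos: "0 \<le> C" using pos R0pos by (simp add: C_def)
  have "0 \<le> \<eta> * \<alpha> ^ 2" using pos by simp
  then have q: "0 \<le> q" "q \<le> 1"
    using step_size_le[OF pos(4,1,2) step(1)] unfolding q_def by linarith+
  have near: "v \<in> cball w0 R" if "norm (v - w0) \<le> C * (1 - q ^ \<tau>)" for v \<tau>
  proof -
    have "C * (1 - q ^ \<tau>) \<le> C * 1" using q Cpos by (intro mult_left_mono) auto
    then show ?thesis using that radius by (simp add: C_def dist_norm norm_minus_commute)
  qed
  have inv: "norm (f (u \<tau>) - y) \<le> q ^ \<tau> * norm (f w0 - y) \<and> norm (u \<tau> - w0) \<le> C * (1 - q ^ \<tau>)" for \<tau>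
  proof (induction \<tau>)
    case 0
    then show ?case by (simp add: u)
  next
    case (Suc \<tau>)
    let ?g = "transpose (J (u \<tau>)) *v (f (u \<tau>) - y)"
    have ut: "u \<tau> \<in> cball w0 R" using Suc near by blast
    have qt: "0 \<le> q ^ \<tau>" "q ^ \<tau> \<le> 1" using q by (auto simp: power_le_one)
    have r: "norm (f (u \<tau>) - y) \<le> q ^ \<tau> * R0"
      using Suc R0 qt by (meson mult_left_mono order_trans)
    have rR: "norm (f (u \<tau>) - y) \<le> R0"
      using r qt R0pos mult_left_le_one_le[of R0 "q ^ \<tau>"] by linarith
    have "norm ?g \<le> \<beta> * norm (f (u \<tau>) - y)"
      by (rule norm_transpose_mult_le) (rule upper[OF ut])
    also have "\<dots> \<le> \<beta> * (q ^ \<tau> * R0)" using r pos by (intro mult_left_mono) auto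
    finally have g: "\<eta> * norm ?g \<le> \<eta> * (\<beta> * (q ^ \<tau> * R0))" using pos by (simp add: mult_left_mono)
    have "u (Suc \<tau>) - w0 = (u \<tau> - w0) - \<eta> *\<^sub>R ?g" by (simp add: u(2))
    then have "norm (u (Suc \<tau>) - w0) \<le> norm (u \<tau> - w0) + norm (\<eta> *\<^sub>R ?g)"
      using norm_triangle_ineq4[of "u \<tau> - w0" "\<eta> *\<^sub>R ?g"] by (simp only:)
    also have "\<dots> \<le> C * (1 - q ^ \<tau>) + \<eta> * (\<beta> * (q ^ \<tau> * R0))"
      using Suc g pos by simp
    \<comment> \<open>\<open>C * (1 - q)\<close> is exactly \<open>\<eta> * \<beta> * R0\<close>, so
      the partial geometric sums telescope.\<close>
    also have "\<dots> = C * (1 - q ^ Suc \<tau>)"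
      using pos by (simp add: C_def q_def field_simps)
    finally have n: "norm (u (Suc \<tau>) - w0) \<le> C * (1 - q ^ Suc \<tau>)" .
    \<comment> \<open>The contraction needs the next iterate in the ball; the distance bound just
      obtained supplies this and uses only the current residual.\<close>
    have "norm (f (u (Suc \<tau>)) - y) \<le> q * norm (f (u \<tau>) - y)"
      unfolding u q_def
      using near[OF n] ut pos step
      by (intro gradient_step_contraction[OF der convex_cball[of w0 R] ut _ pl[OF ut] upper[OF ut] lip[OF _ ut] rR])
        (auto simp: u)
    also have "\<dots> \<le> q * (q ^ \<tau> * norm (f w0 - y))" using Suc q by (intro mult_left_mono) auto
    finally show ?case using n by (simp add: mult.assoc)
  qed
  show "norm (f (u \<tau>) - y) \<le> (1 - \<eta> * \<alpha> ^ 2 / 2) ^ \<tau> * norm (f w0 - y)"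
    using inv by (simp add: q_def)
  have "C * (1 - q ^ \<tau>) \<le> C * 1" using q Cpos by (intro mult_left_mono) auto
  then show "norm (u \<tau> - w0) \<le> 2 * \<beta> / \<alpha> ^ 2 * R0"
    using inv[of \<tau>] by (simp add: C_def)
qed

text \<open>Discrete Gronwall: the distance \<open>d\<close> of the two paths obeys the recursion
  \<open>(1 + \<eta> * \<kappa>) * d + \<eta> * \<gamma>\<close>. The estimates hold only inside the
  ball, so the condition \<open>path\<close> reserves room there for the largest deviation up to
  time \<open>T\<close>.\<close>

lemma gradient_descent_perturbation:
  fixes f ft :: "real ^ 'a \<Rightarrow> real ^ 'b" and J Jt :: "real ^ 'a \<Rightarrow> real ^ 'a ^ 'b"
  assumes der: "\<And>w. (ft has_derivative (*v) (Jt w)) (at w)"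
    and upper: "\<And>w h. w \<in> cball w0 R \<Longrightarrow> norm (Jt w *v h) \<le> \<beta> * norm h"
    and lip: "\<And>v w h. v \<in> cball w0 R \<Longrightarrow> w \<in> cball w0 R \<Longrightarrow>
      norm (Jt v *v h - Jt w *v h) \<le> L * norm (v - w) * norm h"
    and dJ: "\<And>w h. w \<in> cball w0 R \<Longrightarrow> norm (J w *v h - Jt w *v h) \<le> \<Delta>J * norm h"
    and df: "\<And>w. w \<in> cball w0 R \<Longrightarrow> norm (f w - ft w) \<le> \<Delta>"
    and pos: "0 \<le> \<beta>" "0 \<le> L" "0 \<le> \<eta>" "0 \<le> \<Delta>J" "0 \<le> \<Delta>" "0 \<le> R0"
    and u: "u 0 = w0" "\<And>\<tau>. u (Suc \<tau>) = u \<tau> - \<eta> *\<^sub>R (transpose (Jt (u \<tau>)) *v (ft (u \<tau>) - y))"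
    and w: "w 0 = w0" "\<And>\<tau>. w (Suc \<tau>) = w \<tau> - \<eta> *\<^sub>R (transpose (J (w \<tau>)) *v (f (w \<tau>) - y))"
    and near: "\<And>\<tau>. norm (u \<tau> - w0) \<le> C"
    and res: "\<And>\<tau>. norm (ft (u \<tau>) - y) \<le> R0"
  defines "\<kappa> \<equiv> L * R0 + \<beta> * (\<beta> + \<Delta>J)" and "\<gamma> \<equiv> \<Delta>J * R0 + (\<beta> + \<Delta>J) * \<Delta>"
  assumes path: "\<eta> * \<gamma> * real T * exp (\<eta> * \<kappa> * real T) \<le> R - C"
    and "\<tau> \<le> T"
  shows "norm (w \<tau> - u \<tau>) \<le> \<eta> * \<gamma> * real \<tau> * exp (\<eta> * \<kappa> * real \<tau>)"
    and "w \<tau> \<in> cball w0 R"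
proof -
  have kg: "0 \<le> \<eta> * \<kappa>" "0 \<le> \<eta> * \<gamma>" using pos by (auto simp: \<kappa>_def \<gamma>_def)
  define b where "b t = \<eta> * \<gamma> * real t * exp (\<eta> * \<kappa> * real t)" for t
  have bmono: "b s \<le> b t" if "s \<le> t" for s t
    unfolding b_def using that kg
    by (intro mult_mono[of "\<eta> * \<gamma> * real s"] mult_left_mono[of "real s"]) (auto intro: mult_left_mono)
  \<comment> \<open>The reference path stays within \<open>C\<close> of \<open>w0\<close>, and by
    monotonicity the deviation at any earlier time fits into the margin
    \<open>R - C\<close>.\<close>
  have inball: "w t \<in> cball w0 R" if "norm (w t - u t) \<le> b t" "t \<le> T" for t
  proof -
    have "norm (w t - w0) \<le> norm (w t - u t) + norm (u t - w0)" by norm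
    also have "\<dots> \<le> b T + C" using that near bmono[OF that(2)] by (meson add_mono order_trans)
    finally show ?thesis using path by (simp add: b_def dist_norm norm_minus_commute)
  qed
  have uball: "u t \<in> cball w0 R" for t
  proof -
    have "0 \<le> b T" using kg by (simp add: b_def)
    then show ?thesis using near[of t] path by (simp add: b_def dist_norm norm_minus_commute)
  qed
  have main: "t \<le> T \<Longrightarrow> norm (w t - u t) \<le> b t" for t
  proof (induction t)
    case 0
    then show ?case by (simp add: u w b_def)
  next
    case (Suc t)
    then have IH: "norm (w t - u t) \<le> b t" by simp
    define d where "d = norm (w t - u t)"
    have wb: "w t \<in> cball w0 R" using inball IH Suc by simp
    note ub = uball[of t]
    have JX: "norm (J (w t) *v h) \<le> (\<beta> + \<Delta>J) * norm h" for h
    proof -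
      have "norm (J (w t) *v h) \<le> norm (Jt (w t) *v h) + norm (J (w t) *v h - Jt (w t) *v h)" by norm
      then show ?thesis using upper[OF wb, of h] dJ[OF wb, of h] by (simp add: algebra_simps)
    qed
    let ?r = "ft (u t) - y" and ?s = "f (w t) - y"
    \<comment> \<open>Two causes change the residual: the perturbed model at the same weights, and
      the clean model at different weights, the latter by the mean value inequality on the convex
      ball.\<close>
    have sr: "norm (?s - ?r) \<le> \<Delta> + \<beta> * d"
    proof -
      have "norm (ft (w t) - ft (u t)) \<le> \<beta> * norm (w t - u t)"
      proof (rule differentiable_bound[OF convex_cball[of w0 R] _ _ wb ub])
        show "(ft has_derivative (*v) (Jt x)) (at x within cball w0 R)" for x
          by (rule has_derivative_at_withinI[OF der])
        show "op_norm (Jt x) \<le> \<beta>" if "x \<in> cball w0 R" for x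
          by (rule onorm_le) (use upper[OF that] in simp)
      qed
      moreover have "norm (?s - ?r) \<le> norm (f (w t) - ft (w t)) + norm (ft (w t) - ft (u t))" by norm
      ultimately show ?thesis using df[OF wb] by (simp add: d_def)
    qed
    have t1: "norm (transpose (J (w t)) *v (?s - ?r)) \<le> (\<beta> + \<Delta>J) * (\<Delta> + \<beta> * d)"
    proof -
      have "norm (transpose (J (w t)) *v (?s - ?r)) \<le> (\<beta> + \<Delta>J) * norm (?s - ?r)"
        by (rule norm_transpose_mult_le) (rule JX)
      then show ?thesis using mult_left_mono[OF sr, of "\<beta> + \<Delta>J"] pos by linarith
    qed
    have t2: "norm (transpose (J (w t) - Jt (w t)) *v ?r) \<le> \<Delta>J * R0"
    proof -
      have "norm (transpose (J (w t) - Jt (w t)) *v ?r) \<le> \<Delta>J * norm ?r"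
        by (rule norm_transpose_mult_le) (simp add: matrix_vector_mult_diff_rdistrib dJ[OF wb])
      then show ?thesis using mult_left_mono[OF res[of t], of \<Delta>J] pos by linarith
    qed
    have t3: "norm (transpose (Jt (w t) - Jt (u t)) *v ?r) \<le> L * d * R0"
    proof -
      have "norm (transpose (Jt (w t) - Jt (u t)) *v ?r) \<le> L * d * norm ?r"
        by (rule norm_transpose_mult_le) (simp add: matrix_vector_mult_diff_rdistrib d_def lip[OF wb ub])
      then show ?thesis using mult_left_mono[OF res[of t], of "L * d"] pos by (auto simp: d_def)
    qed
    have tr: "transpose (M - N) = transpose M - transpose N" for M N :: "real ^ 'a ^ 'b"
      by (simp add: transpose_def vec_eq_iff)
    \<comment> \<open>Three sources of gradient error: the residual, the Jacobian under the change
      of model, and the Jacobian under the change of weights. Both Jacobian terms are paired with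
      the reference residual, which is bounded by \<open>R0\<close> throughout.\<close>
    have split: "transpose (J (w t)) *v ?s - transpose (Jt (u t)) *v ?r =
      transpose (J (w t)) *v (?s - ?r) + transpose (J (w t) - Jt (w t)) *v ?r
        + transpose (Jt (w t) - Jt (u t)) *v ?r"
      by (simp add: tr matrix_vector_mult_diff_rdistrib matrix_vector_mult_diff_distrib)
    have "norm (transpose (J (w t)) *v ?s - transpose (Jt (u t)) *v ?r)
      \<le> (\<beta> + \<Delta>J) * (\<Delta> + \<beta> * d) + \<Delta>J * R0 + L * d * R0"
      unfolding split by (intro norm_triangle_mono t1 t2 t3)
    also have "\<dots> = \<kappa> * d + \<gamma>" by (simp add: \<kappa>_def \<gamma>_def algebra_simps)
    finally have G: "\<eta> * norm (transpose (J (w t)) *v ?s - transpose (Jt (u t)) *v ?r) \<le> \<eta> * (\<kappa> * d + \<gamma>)"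
      using pos by (simp add: mult_left_mono)
    have "w (Suc t) - u (Suc t) = (w t - u t)
        - \<eta> *\<^sub>R (transpose (J (w t)) *v ?s - transpose (Jt (u t)) *v ?r)"
      unfolding w u by (simp add: scaleR_diff_right)
    then have "norm (w (Suc t) - u (Suc t)) \<le> d
        + norm (\<eta> *\<^sub>R (transpose (J (w t)) *v ?s - transpose (Jt (u t)) *v ?r))"
      unfolding d_def by (metis norm_triangle_ineq4)
    also have "\<dots> \<le> d + \<eta> * (\<kappa> * d + \<gamma>)" using G pos by simp
    also have "\<dots> = (1 + \<eta> * \<kappa>) * d + \<eta> * \<gamma>" by (simp add: algebra_simps)
    \<comment> \<open>The first term uses \<open>1 + s\<close> at most \<open>exp s\<close>. The
      second is inflated by an exponential at least 1 so that the sum is exactly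
      \<open>b (Suc t)\<close>.\<close>
    also have "\<dots> \<le> exp (\<eta> * \<kappa>) * b t + \<eta> * \<gamma> * exp (\<eta> * \<kappa> * real (Suc t))"
    proof (rule add_mono)
      show "(1 + \<eta> * \<kappa>) * d \<le> exp (\<eta> * \<kappa>) * b t"
        using IH kg by (intro mult_mono) (auto simp: d_def intro: exp_ge_add_one_self)
      have "1 \<le> exp (\<eta> * \<kappa> * real (Suc t))" using kg by simp
      then show "\<eta> * \<gamma> \<le> \<eta> * \<gamma> * exp (\<eta> * \<kappa> * real (Suc t))"
        using mult_left_mono[OF _ kg(2), of 1] by simp
    qed
    also have "\<dots> = b (Suc t)" by (simp add: b_def exp_add algebra_simps)
    finally show ?case .
  qed
  show "norm (w \<tau> - u \<tau>) \<le> \<eta> * \<gamma> * real \<tau> * exp (\<eta> * \<kappa> * real \<tau>)"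
    using main[OF \<open>\<tau> \<le> T\<close>] by (simp add: b_def)
  show "w \<tau> \<in> cball w0 R" using inball main \<open>\<tau> \<le> T\<close> by blast
qed

section \<open>The network and its Jacobian\<close>

lemma block_stack [simp]: "block (stack v) i = v i"
  by (simp add: block_def stack_def vec_eq_iff)

lemma stack_block [simp]: "stack (block z) = z"
  by (simp add: block_def stack_def vec_eq_iff)

lemma stack_diff: "stack a - stack b = stack (\<lambda>i. a i - b i)"
  by (simp add: stack_def vec_eq_iff)

lemma block_diff: "block (a - b) i = block a i - block b i"
  by (simp add: block_def vec_eq_iff)

lemma inner_stack: "stack a \<bullet> stack b = (\<Sum>i\<in>UNIV. a i \<bullet> b i)"
  by (simp add: stack_def inner_vec_def sum.cartesian_product case_prod_unfold flip: UNIV_Times_UNIV)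

lemma norm_stack: "norm (stack v) ^ 2 = (\<Sum>i\<in>UNIV. norm (v i) ^ 2)"
  by (simp add: power2_norm_eq_inner inner_stack)

lemma norm_block_le: "norm (block z i) \<le> norm z"
proof -
  have "norm (block z i) ^ 2 \<le> (\<Sum>i\<in>UNIV. norm (block z i) ^ 2)"
    by (rule member_le_sum) auto
  then show ?thesis
    using norm_stack[of "block z"] by (simp add: power2_le_imp_le)
qed

lemma norm_stack_le:
  fixes v :: "'n::finite \<Rightarrow> real ^ 'p::finite"
  assumes "\<And>i. norm (v i) \<le> C"
  shows "norm (stack v) \<le> sqrt (real CARD('n)) * C"
proof -
  have C: "0 \<le> C" using assms norm_ge_zero order_trans by blast
  have "norm (stack v) ^ 2 \<le> (\<Sum>i\<in>(UNIV :: 'n set). C ^ 2)"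
    unfolding norm_stack by (intro sum_mono power_mono assms) auto
  also have "\<dots> = (sqrt (real CARD('n)) * C) ^ 2" by (simp add: power_mult_distrib)
  finally show ?thesis using C by (auto intro: power2_le_imp_le)
qed

section \<open>Vectorization of weight matrices\<close>

lemma vec_to_mat_to_vec [simp]: "vec_to_mat (mat_to_vec V) = V"
  by (simp add: vec_to_mat_def mat_to_vec_def vec_eq_iff)

lemma mat_to_vec_to_mat [simp]: "mat_to_vec (vec_to_mat w) = w"
  by (simp add: vec_to_mat_def mat_to_vec_def vec_eq_iff)

lemma bounded_linear_vec_to_mat: "bounded_linear vec_to_mat"
  by (intro linear_conv_bounded_linear[THEN iffD1] linearI)
    (simp_all add: vec_to_mat_def vec_eq_iff)

lemma mat_to_vec_diff: "mat_to_vec V - mat_to_vec U = mat_to_vec (V - U)"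
  by (simp add: mat_to_vec_def vec_eq_iff)

lemma vec_to_mat_diff: "vec_to_mat v - vec_to_mat u = vec_to_mat (v - u)"
  by (simp add: vec_to_mat_def vec_eq_iff)

text \<open>Vectorization permutes entries, hence is an isometry. Frobenius balls of weights thus
  become Euclidean \<open>cball\<close>s, where the descent lemmas apply.\<close>

lemma norm_mat_to_vec [simp]: "norm (mat_to_vec V) = norm V"
proof -
  have "mat_to_vec V \<bullet> mat_to_vec V = V \<bullet> V"
    by (simp add: mat_to_vec_def inner_vec_def sum.cartesian_product' case_prod_unfold
        sum.swap[of _ "UNIV :: 'a set"] flip: UNIV_Times_UNIV)
  then show ?thesis by (simp add: norm_eq_sqrt_inner)
qed

lemma norm_vec_to_mat [simp]: "norm (vec_to_mat w) = norm w"
  by (metis mat_to_vec_to_mat norm_mat_to_vec)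

text \<open>Row-wise Cauchy-Schwarz; \<open>norm M\<close> is the Frobenius norm.\<close>

lemma norm_matrix_vector_mult_le: "norm (M *v x) \<le> norm M * norm (x :: real ^ 'a)"
proof -
  have "norm ((M *v x) $ i) \<le> norm ((norm x *\<^sub>R M) $ i)" for i
    using Cauchy_Schwarz_ineq2[of "M $ i" x] by (simp add: matrix_vector_mul_component mult.commute)
  then have "norm (M *v x) \<le> norm (norm x *\<^sub>R M)"
    unfolding norm_vec_def[of "M *v x"] norm_vec_def[of "norm x *\<^sub>R M"] by (intro L2_set_mono) auto
  then show ?thesis by (simp add: mult.commute)
qed

lemma norm_le_op_norm: "norm (M *v z) \<le> op_norm M * norm z" for M :: "real ^ 'a ^ 'b"
  by (rule onorm) simp

lemma op_norm_nonneg: "0 \<le> op_norm M" for M :: "real ^ 'a ^ 'b"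
  by (rule onorm_pos_le) simp

lemma abs_diff_le_deriv_bound:
  fixes \<psi> :: "real \<Rightarrow> real"
  assumes "\<And>t. \<psi> differentiable (at t)" "\<And>t. \<bar>deriv \<psi> t\<bar> \<le> B"
  shows "\<bar>\<psi> s - \<psi> t\<bar> \<le> B * \<bar>s - t\<bar>"
proof -
  have "norm (\<psi> s - \<psi> t) \<le> B * norm (s - t)"
    using assms
    by (intro field_differentiable_bound[of UNIV \<psi> "deriv \<psi>"])
      (auto simp: DERIV_deriv_iff_real_differentiable)
  then show ?thesis by simp
qed

text \<open>The differential of \<open>net\<close> in the weights, in direction \<open>V\<close>,
  kept on matrices so that it can be estimated one sample at a time.\<close>

definition dnet ::
  "real ^ 'h::finite ^ 'p::finite \<Rightarrow> (real \<Rightarrow> real) \<Rightarrow> real ^ 'p ^ 'h \<Rightarrow> real ^ 'p \<Rightarrow> real ^ 'p ^ 'h \<Rightarrow> real ^ 'p"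
  where "dnet A \<phi> W x V = A *v (\<chi> h. deriv \<phi> ((W *v x) $ h) * (V *v x) $ h)"

lemma has_derivative_net:
  assumes "\<And>t. \<phi> differentiable (at t)"
  shows "((\<lambda>W. net A \<phi> W x) has_derivative dnet A \<phi> W x) (at W)"
proof -
  have lin: "bounded_linear (\<lambda>V::real^'a^'b. (V *v x) $ h)" for h
    by (intro linear_conv_bounded_linear[THEN iffD1] linearI)
      (simp_all add: matrix_vector_mult_add_rdistrib scaleR_matrix_vector_assoc[symmetric])
  have "((\<lambda>W. (\<chi> h. \<phi> ((W *v x) $ h))) has_derivative
      (\<lambda>V. \<chi> h. deriv \<phi> ((W *v x) $ h) * (V *v x) $ h)) (at W)"
  proof (subst has_derivative_componentwise_within, intro ballI)
    fix b :: "real ^ 'b" assume "b \<in> Basis"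
    then obtain h where b: "b = axis h 1" by (auto simp: Basis_vec_def)
    have "(\<phi> has_derivative (\<lambda>s. deriv \<phi> ((W *v x) $ h) * s)) (at ((W *v x) $ h))"
      using assms DERIV_deriv_iff_real_differentiable has_field_derivative_def by blast
    from has_derivative_compose[OF bounded_linear_imp_has_derivative[OF lin] this]
    show "((\<lambda>W. (\<chi> h. \<phi> ((W *v x) $ h)) \<bullet> b) has_derivative
        (\<lambda>V. (\<chi> h. deriv \<phi> ((W *v x) $ h) * (V *v x) $ h) \<bullet> b)) (at W)"
      by (simp add: b inner_axis)
  qed
  from bounded_linear.has_derivative[OF matrix_vector_mul_bounded_linear this, of A]
  show ?thesis by (simp add: net_def[abs_def] dnet_def[abs_def])
qed

lemma has_derivative_stack:
  fixes f :: "'c::finite \<Rightarrow> 'a::real_normed_vector \<Rightarrow> real ^ 'd::finite"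
  assumes "\<And>i. (f i has_derivative f' i) (at w)"
  shows "((\<lambda>w. stack (\<lambda>i. f i w)) has_derivative (\<lambda>h. stack (\<lambda>i. f' i h))) (at w)"
proof (subst has_derivative_componentwise_within, intro ballI)
  fix b :: "real ^ ('c \<times> 'd)" assume "b \<in> Basis"
  then obtain i j where b: "b = axis (i, j) 1" by (auto simp: Basis_vec_def)
  show "((\<lambda>w. stack (\<lambda>i. f i w) \<bullet> b) has_derivative (\<lambda>h. stack (\<lambda>i. f' i h) \<bullet> b)) (at w)"
    using bounded_linear.has_derivative[OF bounded_linear_vec_nth assms, of i j]
    by (simp add: b inner_axis stack_def)
qed

text \<open>\<open>frechet_derivative\<close> is defined by choice; uniqueness of the derivative
  identifies it with the explicit blockwise formula.\<close>

lemma net_jacobian_works: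
  assumes "\<And>t. \<phi> differentiable (at t)"
  shows "((\<lambda>w. net_stack A \<phi> (vec_to_mat w) x) has_derivative (*v) (net_jacobian A \<phi> x (vec_to_mat w))) (at w)"
    and "net_jacobian A \<phi> x W *v h = stack (\<lambda>i. dnet A \<phi> W (x i) (vec_to_mat h))"
proof -
  have D: "((\<lambda>w. net_stack A \<phi> (vec_to_mat w) x) has_derivative
      (\<lambda>h. stack (\<lambda>i. dnet A \<phi> (vec_to_mat w) (x i) (vec_to_mat h)))) (at w)" for w
    unfolding net_stack_def
    by (intro has_derivative_stack has_derivative_compose[OF _ has_derivative_net, OF _ assms]
        bounded_linear_imp_has_derivative bounded_linear_vec_to_mat)
  have J: "(*v) (net_jacobian A \<phi> x (vec_to_mat w)) =
      (\<lambda>h. stack (\<lambda>i. dnet A \<phi> (vec_to_mat w) (x i) (vec_to_mat h)))" for w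
    unfolding net_jacobian_def mat_to_vec_to_mat frechet_derivative_at[OF D, symmetric]
    by (rule matrix_vector_mul(2)[OF has_derivative_linear[OF D]])
  show "((\<lambda>w. net_stack A \<phi> (vec_to_mat w) x) has_derivative (*v) (net_jacobian A \<phi> x (vec_to_mat w))) (at w)"
    unfolding J by (rule D)
  show "net_jacobian A \<phi> x W *v h = stack (\<lambda>i. dnet A \<phi> W (x i) (vec_to_mat h))"
    using J[of "mat_to_vec W"] by simp
qed

lemma norm_net_diff_le:
  assumes "\<And>t. \<phi> differentiable (at t)" "\<And>t. \<bar>deriv \<phi> t\<bar> \<le> B1"
  shows "norm (net A \<phi> W x - net A \<phi> W y) \<le> op_norm A * B1 * norm W * norm (x - y)"
proof -
  have B1: "0 \<le> B1" using assms(2)[of 0] by linarith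
  let ?d = "(\<chi> h. \<phi> ((W *v x) $ h)) - (\<chi> h. \<phi> ((W *v y) $ h))"
  have "norm ?d \<le> norm (B1 *\<^sub>R (W *v (x - y)))"
    using abs_diff_le_deriv_bound[OF assms] B1
    by (intro norm_le_componentwise_cart) (simp add: matrix_vector_mult_diff_distrib abs_mult)
  also have "\<dots> \<le> B1 * (norm W * norm (x - y))"
    using B1 by (simp add: mult_left_mono norm_matrix_vector_mult_le)
  finally have "op_norm A * norm ?d \<le> op_norm A * (B1 * (norm W * norm (x - y)))"
    by (intro mult_left_mono op_norm_nonneg)
  then show ?thesis
    using norm_le_op_norm[of A ?d]
    by (simp add: net_def matrix_vector_mult_diff_distrib mult.assoc)
qed

text \<open>The product is split asymmetrically: \<open>?a\<close> changes the input of the linear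
  factor, \<open>?b\<close> the argument of the activation derivative. Only \<open>norm y\<close>
  then appears, and for a clean input \<open>y\<close> it is bounded by the size of the
  centers.\<close>

lemma norm_dnet_diff_le:
  assumes "\<And>t. deriv \<phi> differentiable (at t)"
    and B: "\<And>t. \<bar>deriv \<phi> t\<bar> \<le> B1" "\<And>t. \<bar>deriv (deriv \<phi>) t\<bar> \<le> B2"
  shows "norm (dnet A \<phi> W x V - dnet A \<phi> W y V)
    \<le> op_norm A * (B1 + B2 * norm W * norm y) * norm (x - y) * norm V"
proof -
  have B0: "0 \<le> B1" "0 \<le> B2" using B(1)[of 0] B(2)[of 0] by linarith+
  let ?c = "\<lambda>x h. deriv \<phi> ((W *v x) $ h)"
  let ?a = "\<chi> h. ?c x h * (V *v (x - y)) $ h"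
  let ?b = "\<chi> h. (?c x h - ?c y h) * (V *v y) $ h"
  have "norm ?a \<le> norm (B1 *\<^sub>R (V *v (x - y)))"
    using B(1) B0 by (intro norm_le_componentwise_cart) (simp add: abs_mult mult_right_mono)
  also have "\<dots> \<le> B1 * (norm V * norm (x - y))"
    using B0 by (simp add: mult_left_mono norm_matrix_vector_mult_le)
  finally have a: "norm ?a \<le> B1 * (norm V * norm (x - y))" .
  have c: "\<bar>?c x h - ?c y h\<bar> \<le> B2 * (norm W * norm (x - y))" for h
  proof -
    have "\<bar>?c x h - ?c y h\<bar> \<le> B2 * \<bar>(W *v (x - y)) $ h\<bar>"
      using abs_diff_le_deriv_bound[OF assms(1) B(2)] by (simp add: matrix_vector_mult_diff_distrib)
    also have "\<dots> \<le> B2 * (norm W * norm (x - y))"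
      using component_le_norm_cart[of "W *v (x - y)" h] norm_matrix_vector_mult_le[of W "x - y"] B0
      by (intro mult_left_mono) auto
    finally show ?thesis .
  qed
  have "norm ?b \<le> norm ((B2 * (norm W * norm (x - y))) *\<^sub>R (V *v y))"
    using c B0 by (intro norm_le_componentwise_cart) (simp add: abs_mult mult_right_mono)
  also have "\<dots> \<le> B2 * (norm W * norm (x - y)) * (norm V * norm y)"
    using B0 by (simp add: abs_mult mult_left_mono norm_matrix_vector_mult_le)
  finally have "norm (?a + ?b) \<le> B1 * (norm V * norm (x - y)) + B2 * (norm W * norm (x - y)) * (norm V * norm y)"
    using a norm_triangle_mono by blast
  then have "op_norm A * norm (?a + ?b) \<le> op_norm A * (B1 * (norm V * norm (x - y)) + B2 * (norm W * norm (x - y)) * (norm V * norm y))"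
    by (intro mult_left_mono op_norm_nonneg)
  moreover have "dnet A \<phi> W x V - dnet A \<phi> W y V = A *v (?a + ?b)"
    unfolding dnet_def matrix_vector_mult_diff_distrib[symmetric]
    by (rule arg_cong[where f = "(*v) A"])
      (simp add: vec_eq_iff matrix_vector_mult_diff_distrib algebra_simps)
  ultimately show ?thesis
    using norm_le_op_norm[of A "?a + ?b"] by (simp add: algebra_simps)
qed

section \<open>Clustered inputs\<close>

lemma sum_over_fibres:
  fixes g :: "'n::finite \<Rightarrow> 'k::finite" and F :: "'k \<Rightarrow> 'a::real_vector"
  shows "(\<Sum>i\<in>UNIV. F (g i)) = (\<Sum>k\<in>UNIV. real (card {i. g i = k}) *\<^sub>R F k)"
proof -
  have "(\<Sum>i\<in>UNIV. F (g i)) = (\<Sum>k\<in>UNIV. \<Sum>i\<in>{i \<in> UNIV. g i = k}. F (g i))"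
    by (rule sum.group[symmetric]) auto
  also have "\<dots> = (\<Sum>k\<in>UNIV. real (card {i. g i = k}) *\<^sub>R F k)"
    by (rule sum.cong) (auto simp: sum_constant_scaleR)
  finally show ?thesis .
qed

lemma norm_stack_comp:
  fixes g :: "'n::finite \<Rightarrow> 'k::finite"
  shows "norm (stack (\<lambda>i. v (g i))) ^ 2 = (\<Sum>k\<in>UNIV. real (card {i. g i = k}) * norm (v k) ^ 2)"
  unfolding norm_stack using sum_over_fibres[of "\<lambda>k. norm (v k) ^ 2" g] by simp

lemma norm_stack_comp_le:
  fixes g :: "'n::finite \<Rightarrow> 'k::finite"
  assumes "\<And>k. real (card {i. g i = k}) \<le> N"
  shows "norm (stack (\<lambda>i. v (g i))) \<le> sqrt N * norm (stack v)"
proof -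
  have N: "0 \<le> N" using assms of_nat_0_le_iff order_trans by blast
  have "norm (stack (\<lambda>i. v (g i))) ^ 2 \<le> (\<Sum>k\<in>UNIV. N * norm (v k) ^ 2)"
    unfolding norm_stack_comp by (intro sum_mono mult_right_mono assms) auto
  also have "\<dots> = (sqrt N * norm (stack v)) ^ 2"
    using N by (simp add: power_mult_distrib norm_stack sum_distrib_left)
  finally show ?thesis using N by (auto intro: power2_le_imp_le)
qed

text \<open>On a cluster-constant vector the transpose of \<open>J\<close> sums equal blocks, so it
  acts as the transpose of \<open>Jc\<close> on blocks weighted by cluster size. This is the source
  of the factor \<open>sqrt n_min\<close> in \<alpha>.\<close>

lemma norm_transpose_cluster_jacobian_ge:
  fixes g :: "'n::finite \<Rightarrow> 'k::finite"
    and J :: "real ^ 'w ^ ('n \<times> 'p::finite)" and Jc :: "real ^ 'w ^ ('k \<times> 'p)"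
  assumes J: "\<And>h. J *v h = stack (\<lambda>i. block (Jc *v h) (g i))"
    and lower: "\<And>z. norm z = 1 \<Longrightarrow> a \<le> norm (transpose Jc *v z)"
    and "0 \<le> a"
    and N: "\<And>k. N \<le> real (card {i. g i = k})" "0 \<le> N"
  shows "sqrt N * a * norm (stack (\<lambda>i. v (g i))) \<le> norm (transpose J *v stack (\<lambda>i. v (g i)))"
proof -
  let ?n = "\<lambda>k. real (card {i. g i = k})"
  let ?z = "stack (\<lambda>i. v (g i))" and ?y = "stack (\<lambda>k. ?n k *\<^sub>R v k)"
  have tr: "x \<bullet> (transpose M *v z) = (M *v x) \<bullet> z" for M :: "real ^ 'a ^ 'b" and x z
    by (metis dot_lmul_matrix inner_commute transpose_matrix_vector)
  have "h \<bullet> (transpose J *v ?z) = h \<bullet> (transpose Jc *v ?y)" for h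
  proof -
    have "h \<bullet> (transpose J *v ?z) = (\<Sum>i\<in>UNIV. block (Jc *v h) (g i) \<bullet> v (g i))"
      by (simp only: tr J inner_stack)
    also have "\<dots> = (\<Sum>k\<in>UNIV. ?n k *\<^sub>R (block (Jc *v h) k \<bullet> v k))"
      by (rule sum_over_fibres)
    also have "\<dots> = (Jc *v h) \<bullet> ?y"
      using inner_stack[of "block (Jc *v h)" "\<lambda>k. ?n k *\<^sub>R v k"] by simp
    finally show ?thesis by (simp only: tr)
  qed
  then have eq: "transpose J *v ?z = transpose Jc *v ?y"
    using vector_eq_ldot by blast
  \<comment> \<open>Repetition weights a squared block norm by the cluster size, while
    \<open>?y\<close> weights it by the square of that size.\<close>
  have "N * norm ?z ^ 2 \<le> norm ?y ^ 2"
    unfolding norm_stack_comp norm_stack[of "\<lambda>k. ?n k *\<^sub>R v k"] sum_distrib_left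
    by (rule sum_mono) (simp add: N mult_mono power_mult_distrib power2_eq_square mult.assoc)
  then have "(sqrt N * norm ?z) ^ 2 \<le> norm ?y ^ 2" using N by (simp add: power_mult_distrib)
  then have zy: "sqrt N * norm ?z \<le> norm ?y" by (rule power2_le_imp_le) simp
  have "a * norm ?y \<le> norm (transpose Jc *v ?y)"
  proof (cases "?y = 0")
    case False
    then have "a \<le> norm (transpose Jc *v ((1 / norm ?y) *\<^sub>R ?y))" by (intro lower) simp
    then show ?thesis using False by (simp add: matrix_vector_mult_scaleR field_simps)
  qed simp
  then show ?thesis
    using mult_left_mono[OF zy \<open>0 \<le> a\<close>] unfolding eq by (simp add: mult_ac)
qed

text \<open>Averaging within clusters is the orthogonal projection onto cluster-constant
  vectors.\<close>

lemma cluster_mean_orthogonal: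
  fixes g :: "'n::finite \<Rightarrow> 'k::finite" and v :: "'k \<Rightarrow> real ^ 'p::finite"
  defines "m x k \<equiv> (1 / real (card {i. g i = k})) *\<^sub>R (\<Sum>i | g i = k. x i)"
  shows "(stack (\<lambda>i. v (g i))) \<bullet> (stack (\<lambda>i. m x (g i)) - stack x) = 0"
proof -
  let ?n = "\<lambda>k. real (card {i. g i = k})"
  \<comment> \<open>For an empty cluster \<open>1 / 0 = 0\<close> and both sides vanish.\<close>
  have m: "?n k *\<^sub>R m x k = (\<Sum>i | g i = k. x i)" for k
    by (cases "{i. g i = k} = {}") (auto simp: m_def card_eq_0_iff simp del: card_0_eq)
  have "(\<Sum>i\<in>UNIV. v (g i) \<bullet> x i) = (\<Sum>k\<in>UNIV. \<Sum>i\<in>{i \<in> UNIV. g i = k}. v (g i) \<bullet> x i)"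
    by (rule sum.group[symmetric]) auto
  also have "\<dots> = (\<Sum>k\<in>UNIV. v k \<bullet> (\<Sum>i | g i = k. x i))"
    by (simp add: inner_sum_right)
  also have "\<dots> = (\<Sum>i\<in>UNIV. v (g i) \<bullet> m x (g i))"
    using sum_over_fibres[of "\<lambda>k. v k \<bullet> m x k" g] by (simp flip: m)
  finally show ?thesis by (simp add: inner_diff_right inner_stack)
qed

text \<open>\<open>1 - c\<close> is at most \<open>exp (- c)\<close>, so a horizon of
  \<open>ln (R / \<nu>) / c\<close> suffices. Applied with
  \<open>c = \<eta> * \<alpha> ^ 2 / 2\<close>, this is the horizon \<open>Tstar\<close>.\<close>

lemma geometric_decay_le:
  assumes c: "0 < c" "c \<le> 1" and "0 \<le> R" "0 < \<nu>"
    and T: "int T \<ge> \<lceil>1 / c * log_plus (R / \<nu>)\<rceil>"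
  shows "(1 - c) ^ T * R \<le> \<nu>"
proof (cases "R = 0")
  case False
  then have R: "0 < R" using \<open>0 \<le> R\<close> by simp
  have "log_plus (R / \<nu>) / c \<le> real T" using T by (simp add: ceiling_le_iff)
  then have "ln (R / \<nu>) \<le> c * real T"
    using c by (simp add: log_plus_def pos_divide_le_eq mult.commute)
  then have "R / \<nu> \<le> exp (c * real T)"
    using R \<open>0 < \<nu>\<close> by (metis divide_pos_pos exp_le_cancel_iff exp_ln)
  then have "R * exp (- (c * real T)) \<le> \<nu>"
    using \<open>0 < \<nu>\<close> by (simp add: exp_minus field_simps)
  moreover have "(1 - c) ^ T \<le> exp (- c) ^ T"
    using c exp_ge_add_one_self[of "- c"] by (intro power_mono) auto
  then have "(1 - c) ^ T * R \<le> exp (- (c * real T)) * R"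
    using R by (simp add: exp_of_nat_mult[symmetric] mult.commute)
  ultimately show ?thesis by (simp add: mult.commute)
qed (use \<open>0 < \<nu>\<close> in simp)

text \<open>The separation \<delta> is an extended real: with a single cluster the infimum over the
  empty set of pairs is infinite and the separation condition holds.\<close>

theorem theoremA11:
  fixes \<mu> :: "'k::finite \<Rightarrow> real ^ 'p::finite"
    and g :: "'n::finite \<Rightarrow> 'k"
    and \<xi> out x xt :: "'n \<Rightarrow> real ^ 'p"
    and A :: "real ^ 'h::finite ^ 'p"
    and \<phi> :: "real \<Rightarrow> real"
    and W0 :: "real ^ 'p ^ 'h"
    and W :: "nat \<Rightarrow> real ^ 'p ^ 'h"
    and D :: "(real ^ 'p ^ 'h) set"
    and \<Lambda> :: "'k \<Rightarrow> 'n set"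
    and \<O> :: "'n set"
    and J :: "real ^ 'p ^ 'h \<Rightarrow> real ^ ('p \<times> 'h) ^ ('n \<times> 'p)"
    and Jc :: "real ^ 'p ^ 'h \<Rightarrow> real ^ ('p \<times> 'h) ^ ('k \<times> 'p)"
    and Rloc \<eta> \<epsilon>c \<epsilon>o \<rho> \<alpha>c \<beta>c Lc B1 B2 :: real
    and n_min n_max \<alpha> \<beta> L Rt0 Rh0 R\<mu> RW \<Delta>f \<Delta>J \<beta>X \<kappa> \<gamma> :: real
    and \<Delta>path \<zeta> :: "nat \<Rightarrow> real"
    and Tstar :: "real \<Rightarrow> int"
    and \<delta> :: ereal
    and T :: nat
  defines "xt \<equiv> \<lambda>i. \<mu> (g i)"
    and "x \<equiv> \<lambda>i. xt i + \<xi> i + out i"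
    and "\<O> \<equiv> {i. out i \<noteq> 0}"
    and "\<Lambda> \<equiv> \<lambda>k. {i. g i = k}"
    and "n_min \<equiv> real (Min (range (\<lambda>k. card (\<Lambda> k))))"
    and "n_max \<equiv> real (Max (range (\<lambda>k. card (\<Lambda> k))))"
    and "D \<equiv> {V. norm (V - W0) \<le> Rloc}"
    and "J \<equiv> net_jacobian A \<phi> x"
    and "Jc \<equiv> net_jacobian A \<phi> \<mu>"
    and "\<alpha> \<equiv> sqrt n_min * \<alpha>c"
    and "\<beta> \<equiv> sqrt n_max * \<beta>c"
    and "L \<equiv> sqrt n_max * Lc"
    and "Rt0 \<equiv> norm (net_stack A \<phi> W0 xt - stack xt)"
    and "Rh0 \<equiv> Rt0 + sqrt (real CARD('n)) * \<epsilon>c + sqrt (\<rho> * real CARD('n)) * \<epsilon>o"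
    and "Tstar \<equiv> \<lambda>\<nu>. \<lceil>2 / (\<eta> * \<alpha> ^ 2) * log_plus (Rh0 / \<nu>)\<rceil>"
    and "R\<mu> \<equiv> Max (range (\<lambda>k. norm (\<mu> k)))"
    and "RW \<equiv> norm W0 + Rloc"
    and "\<Delta>f \<equiv> op_norm A * B1 * RW * (\<epsilon>c + \<epsilon>o)"
    and "\<Delta>J \<equiv> sqrt (real CARD('n)) * op_norm A * (B1 + B2 * RW * R\<mu>) * (\<epsilon>c + \<epsilon>o)"
    and "\<beta>X \<equiv> \<beta> + \<Delta>J"
    and "\<kappa> \<equiv> L * Rh0 + \<beta> * \<beta>X"
    and "\<gamma> \<equiv> \<Delta>J * Rh0 + \<beta>X * sqrt (real CARD('n)) * \<Delta>f"
    and "\<Delta>path \<equiv> \<lambda>t. \<eta> * \<gamma> * real t * exp (\<eta> * \<kappa> * real t)"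
    and "\<zeta> \<equiv> \<lambda>t. \<Delta>f + \<beta> * \<Delta>path t"
    and "\<delta> \<equiv> (INF (a, b) \<in> {(a, b). a \<noteq> b}. ereal (norm (\<mu> a - \<mu> b)))"
  assumes clusters_nonempty: "\<forall>k. card (\<Lambda> k) \<ge> 1"
    and Rloc_pos: "Rloc > 0"
    and gd_init: "W 0 = W0"
    and gd_step: "\<forall>\<tau>. mat_to_vec (W (Suc \<tau>)) =
        mat_to_vec (W \<tau>) - \<eta> *\<^sub>R (transpose (J (W \<tau>)) *v (net_stack A \<phi> (W \<tau>) x - stack x))"
    and eps_c: "\<epsilon>c \<ge> 0"
    and within_cluster: "\<forall>i. norm (\<xi> i) \<le> \<epsilon>c"
    and rho_pos: "\<rho> > 0"
    and outlier_rate: "Max (range (\<lambda>k. real (card (\<O> \<inter> \<Lambda> k)) / real (card (\<Lambda> k)))) \<le> \<rho>"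
    and eps_o: "\<epsilon>o \<ge> 0"
    and outlier_magnitude: "\<forall>i\<in>\<O>. norm (out i) \<le> \<epsilon>o"
    and eps_pos: "\<epsilon>c + \<rho> * \<epsilon>o > 0"
    and Jc_consts_pos: "\<alpha>c > 0" "\<beta>c > 0" "Lc > 0"
    and Jc_bounds: "\<forall>V\<in>D. \<forall>z. norm z = 1 \<longrightarrow>
        \<alpha>c \<le> norm (transpose (Jc V) *v z) \<and> norm (transpose (Jc V) *v z) \<le> \<beta>c"
    and Jc_lipschitz: "\<forall>V1\<in>D. \<forall>V2\<in>D. op_norm (Jc V1 - Jc V2) \<le> Lc * norm (V1 - V2)"
    and radius: "Rloc \<ge> 2 * \<beta> / \<alpha> ^ 2 * Rh0"
    and phi_diff: "\<forall>t. \<phi> differentiable (at t)" "\<forall>t. deriv \<phi> differentiable (at t)"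
    and phi_bounds: "\<forall>t. \<bar>deriv \<phi> t\<bar> \<le> B1" "\<forall>t. \<bar>deriv (deriv \<phi>) t\<bar> \<le> B2"
    and step_size: "0 < \<eta>"
        "\<eta> \<le> min (\<alpha> ^ 2 / (8 * \<beta> ^ 4)) (\<alpha> ^ 2 / (2 * L * \<beta> ^ 2 * Rh0))"
    and T_large: "int T \<ge> Tstar (\<epsilon>c + \<rho> * \<epsilon>o)"
    and path_small: "\<Delta>path T \<le> Rloc - 2 * \<beta> / \<alpha> ^ 2 * Rh0"
    and separation: "\<delta> > ereal (2 * \<zeta> T + 4 * (\<epsilon>c + \<rho> * \<epsilon>o))"
  shows "norm_2inf (net_stack A \<phi> (W T) x - stack xt) \<le> \<zeta> T + 2 * (\<epsilon>c + \<rho> * \<epsilon>o) \<and>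
    (\<forall>i. norm (net A \<phi> (W T) (x i) - \<mu> (g i)) \<le> \<zeta> T + 2 * (\<epsilon>c + \<rho> * \<epsilon>o)) \<and>
    (\<forall>i. {k. is_arg_min (\<lambda>k. norm (net A \<phi> (W T) (x i) - \<mu> k)) (\<lambda>_. True) k} = {g i})"
proof -
  define f where "f w = net_stack A \<phi> (vec_to_mat w) x" for w
  define ft where "ft w = net_stack A \<phi> (vec_to_mat w) xt" for w
  define JX where "JX w = J (vec_to_mat w)" for w
  define Jt where "Jt w = (net_jacobian A \<phi> xt (vec_to_mat w) :: real ^ ('p \<times> 'h) ^ ('n \<times> 'p))" for w
  define w0 where "w0 = mat_to_vec W0"
  \<comment> \<open>\<open>p\<close> is the projection of the noisy targets onto cluster-constant
    vectors.\<close>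
  define m where "m k = (1 / real (card (\<Lambda> k))) *\<^sub>R (\<Sum>i\<in>\<Lambda> k. x i)" for k
  define p where "p = stack (\<lambda>i. m (g i))"
  \<comment> \<open>The reference descent keeps the noisy targets \<open>stack x\<close> and
    replaces only the inputs, so it has the same target as the actual descent.\<close>
  define u where "u = rec_nat w0 (\<lambda>_ v. v - \<eta> *\<^sub>R (transpose (Jt v) *v (ft v - stack x)))"
  define \<nu> where "\<nu> = \<epsilon>c + \<rho> * \<epsilon>o"
  have u: "u 0 = w0" "u (Suc \<tau>) = u \<tau> - \<eta> *\<^sub>R (transpose (Jt (u \<tau>)) *v (ft (u \<tau>) - stack x))" for \<tau>
    by (simp_all add: u_def)
  have \<phi>': "\<And>t. \<phi> differentiable (at t)" "\<And>t. deriv \<phi> differentiable (at t)"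
    "\<And>t. \<bar>deriv \<phi> t\<bar> \<le> B1" "\<And>t. \<bar>deriv (deriv \<phi>) t\<bar> \<le> B2"
    using phi_diff phi_bounds by auto
  have B: "0 \<le> B1" "0 \<le> B2" using \<phi>'(3,4)[of 0] by linarith+
  have nk: "n_min \<le> real (card (\<Lambda> k))" "real (card (\<Lambda> k)) \<le> n_max" for k
    by (simp_all add: n_min_def n_max_def)
  have nk1: "1 \<le> real (card (\<Lambda> k))" for k using clusters_nonempty by auto
  have n1: "1 \<le> n_min" using clusters_nonempty by (simp add: n_min_def)
  then have n2: "n_min \<le> n_max" using nk order_trans by blast

  \<comment> \<open>Admissible weights and bounds on the centers\<close>
  have D: "vec_to_mat w \<in> D" if "w \<in> cball w0 Rloc" for w
  proof -
    have "norm (mat_to_vec (vec_to_mat w - W0)) \<le> Rloc"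
      using that by (simp add: w0_def dist_norm norm_minus_commute flip: mat_to_vec_diff)
    then show ?thesis by (simp add: D_def)
  qed
  have RW: "norm V \<le> RW" if "V \<in> D" for V
    using that norm_triangle_sub[of V W0] by (simp add: RW_def D_def)
  have RW0: "0 \<le> RW" using Rloc_pos by (simp add: RW_def)
  have R\<mu>: "norm (\<mu> k) \<le> R\<mu>" for k by (simp add: R\<mu>_def)
  then have R\<mu>0: "0 \<le> R\<mu>" using norm_ge_zero order_trans by blast

  \<comment> \<open>Size of the noise and of the outliers\<close>
  have out: "norm (out i) \<le> \<epsilon>o" for i
    using outlier_magnitude eps_o by (cases "i \<in> \<O>") (auto simp: \<O>_def)
  have xxt: "norm (x i - xt i) \<le> \<epsilon>c + \<epsilon>o" for i
    using norm_triangle_mono[OF within_cluster[rule_format, of i] out[of i]] by (simp add: x_def)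
  have rate: "real (card (\<O> \<inter> \<Lambda> k)) \<le> \<rho> * real (card (\<Lambda> k))" for k
  proof -
    have "real (card (\<O> \<inter> \<Lambda> k)) / real (card (\<Lambda> k)) \<le> \<rho>"
      using outlier_rate by simp
    then show ?thesis using nk1[of k] by (simp add: pos_divide_le_eq)
  qed
  \<comment> \<open>Summing the rate over clusters leaves at most \<rho> times the sample count of
    outliers, hence the square root of that count.\<close>
  have nout: "norm (stack out) \<le> sqrt (\<rho> * real CARD('n)) * \<epsilon>o"
  proof -
    have "card \<O> = (\<Sum>k\<in>UNIV. card {i \<in> \<O>. g i = k})"
      using sum.group[of \<O> UNIV g "\<lambda>_. 1::nat"] by simp
    then have "real (card \<O>) = (\<Sum>k\<in>UNIV. real (card (\<O> \<inter> \<Lambda> k)))"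
      by (simp add: \<Lambda>_def Int_def)
    also have "\<dots> \<le> (\<Sum>k\<in>UNIV. \<rho> * real (card (\<Lambda> k)))" by (intro sum_mono rate)
    also have "\<dots> = \<rho> * real CARD('n)"
      using sum_over_fibres[of "\<lambda>_. 1::real" g] by (simp add: \<Lambda>_def flip: sum_distrib_left)
    finally have card: "real (card \<O>) \<le> \<rho> * real CARD('n)" .
    have "norm (stack out) ^ 2 = (\<Sum>i\<in>\<O>. norm (out i) ^ 2)"
      unfolding norm_stack by (rule sum.mono_neutral_right) (auto simp: \<O>_def)
    also have "\<dots> \<le> (\<Sum>i\<in>\<O>. \<epsilon>o ^ 2)" by (intro sum_mono power_mono out) auto
    also have "\<dots> \<le> (sqrt (\<rho> * real CARD('n)) * \<epsilon>o) ^ 2"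
      using card rho_pos by (simp add: power_mult_distrib mult_right_mono)
    finally show ?thesis using eps_o rho_pos by (auto intro: power2_le_imp_le)
  qed
  \<comment> \<open>Averaging dilutes the outliers: their share of a cluster is at most \<rho>, so
    they move its mean by at most \<open>\<rho> * \<epsilon>o\<close>.\<close>
  have mean: "norm (m k - \<mu> k) \<le> \<nu>" for k
  proof -
    define n where "n = real (card (\<Lambda> k))"
    have n: "0 < n" using nk1[of k] by (simp add: n_def)
    have "(\<Sum>i\<in>\<Lambda> k. x i) = n *\<^sub>R \<mu> k + (\<Sum>i\<in>\<Lambda> k. \<xi> i) + (\<Sum>i\<in>\<Lambda> k. out i)"
      by (simp add: x_def xt_def sum.distrib \<Lambda>_def sum_constant_scaleR n_def del: sum_constant)
    then have mk: "m k - \<mu> k = (1 / n) *\<^sub>R ((\<Sum>i\<in>\<Lambda> k. \<xi> i) + (\<Sum>i\<in>\<Lambda> k. out i))"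
      using n by (simp add: m_def n_def[symmetric] scaleR_add_right)
    have "norm (\<Sum>i\<in>\<Lambda> k. \<xi> i) \<le> n * \<epsilon>c"
      using sum_norm_le[of "\<Lambda> k" \<xi> "\<lambda>_. \<epsilon>c"] within_cluster by (simp add: n_def)
    moreover have "norm (\<Sum>i\<in>\<Lambda> k. out i) \<le> \<rho> * n * \<epsilon>o"
    proof -
      have "(\<Sum>i\<in>\<Lambda> k. out i) = (\<Sum>i\<in>\<O> \<inter> \<Lambda> k. out i)"
        by (rule sum.mono_neutral_right) (auto simp: \<O>_def)
      also have "norm \<dots> \<le> real (card (\<O> \<inter> \<Lambda> k)) * \<epsilon>o"
        using sum_norm_le[of "\<O> \<inter> \<Lambda> k" out "\<lambda>_. \<epsilon>o"] out by simp
      also have "\<dots> \<le> \<rho> * n * \<epsilon>o" unfolding n_def using rate eps_o by (rule mult_right_mono)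
      finally show ?thesis .
    qed
    ultimately have "norm ((\<Sum>i\<in>\<Lambda> k. \<xi> i) + (\<Sum>i\<in>\<Lambda> k. out i)) \<le> n * \<epsilon>c + \<rho> * n * \<epsilon>o"
      by (rule norm_triangle_mono)
    then show ?thesis
      unfolding mk \<nu>_def using n by (simp add: pos_divide_le_eq) (simp add: algebra_simps)
  qed

  \<comment> \<open>The least-squares problem with clean inputs\<close>
  have Jc_up: "norm (Jc V *v h) \<le> \<beta>c * norm h" if "V \<in> D" for V h
  proof -
    have "norm (transpose (Jc V) *v z) \<le> \<beta>c * norm z" for z
    proof (cases "z = 0")
      case False
      then have "norm (transpose (Jc V) *v ((1 / norm z) *\<^sub>R z)) \<le> \<beta>c"
        using Jc_bounds that by simp
      then show ?thesis using False
        unfolding matrix_vector_mult_scaleR by (simp add: pos_divide_le_eq)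
    qed simp
    from norm_transpose_mult_le[OF this] show ?thesis by simp
  qed
  \<comment> \<open>A clean input is its cluster center, so each Jacobian block repeats the block of
    the cluster.\<close>
  have Jt: "Jt w *v h = stack (\<lambda>i. block (Jc (vec_to_mat w) *v h) (g i))" for w h
    unfolding Jt_def Jc_def net_jacobian_works(2)[OF \<phi>'(1)] by (simp add: xt_def)
  have der: "(ft has_derivative (*v) (Jt w)) (at w)" for w
    unfolding ft_def[abs_def] Jt_def by (rule net_jacobian_works(1)[OF \<phi>'(1)])
  have upper: "norm (Jt w *v h) \<le> \<beta> * norm h" if "w \<in> cball w0 Rloc" for w h
  proof -
    have "norm (Jt w *v h) \<le> sqrt n_max * norm (Jc (vec_to_mat w) *v h)"
      using norm_stack_comp_le[of g n_max "block (Jc (vec_to_mat w) *v h)"] nk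
      by (simp add: Jt \<Lambda>_def)
    also have "\<dots> \<le> sqrt n_max * (\<beta>c * norm h)"
      using Jc_up[OF D[OF that]] n1 n2 by (intro mult_left_mono) auto
    finally show ?thesis by (simp add: \<beta>_def mult.assoc)
  qed
  have lip: "norm (Jt v *v h - Jt w *v h) \<le> L * norm (v - w) * norm h"
    if "v \<in> cball w0 Rloc" "w \<in> cball w0 Rloc" for v w h
  proof -
    let ?M = "Jc (vec_to_mat v) - Jc (vec_to_mat w)"
    have "norm (Jt v *v h - Jt w *v h) \<le> sqrt n_max * norm (?M *v h)"
      using norm_stack_comp_le[of g n_max "block (?M *v h)"] nk
      by (simp add: Jt \<Lambda>_def stack_diff matrix_vector_mult_diff_rdistrib block_diff)
    also have "\<dots> \<le> sqrt n_max * (Lc * norm (v - w) * norm h)"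
    proof (intro mult_left_mono)
      have "op_norm ?M \<le> Lc * norm (v - w)"
        using Jc_lipschitz D that vec_to_mat_diff norm_vec_to_mat by metis
      then show "norm (?M *v h) \<le> Lc * norm (v - w) * norm h"
        by (intro order_trans[OF norm_le_op_norm] mult_right_mono) auto
    qed (use n1 n2 in simp)
    finally show ?thesis by (simp add: L_def mult.assoc)
  qed
  have ftp: "ft w - p = stack (\<lambda>i. net A \<phi> (vec_to_mat w) (\<mu> (g i)) - m (g i))" for w
    by (simp add: ft_def p_def net_stack_def stack_diff xt_def)
  \<comment> \<open>The residual against \<open>p\<close> is cluster-constant, which is where the
    lower bound on the Jacobian holds.\<close>
  have pl: "\<alpha> * norm (ft w - p) \<le> norm (transpose (Jt w) *v (ft w - p))" if "w \<in> cball w0 Rloc" for w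
    unfolding ftp \<alpha>_def
    using Jc_bounds D[OF that] Jc_consts_pos nk n1
    by (intro norm_transpose_cluster_jacobian_ge[OF Jt]) (auto simp: \<Lambda>_def)
  have orth: "stack (\<lambda>i. v (g i)) \<bullet> (p - stack x) = 0" for v
    using cluster_mean_orthogonal[of v g x] by (simp add: p_def m_def \<Lambda>_def)
  \<comment> \<open>\<open>p - stack x\<close> is orthogonal to the range of \<open>Jt w\<close>, so
    descent towards \<open>stack x\<close> is also descent towards \<open>p\<close>.\<close>
  have grad: "transpose (Jt w) *v (ft w - stack x) = transpose (Jt w) *v (ft w - p)" for w
  proof -
    have "h \<bullet> (transpose (Jt w) *v (p - stack x)) = (Jt w *v h) \<bullet> (p - stack x)" for h
      by (metis dot_lmul_matrix inner_commute transpose_matrix_vector)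
    then have "h \<bullet> (transpose (Jt w) *v (p - stack x)) = 0" for h
      by (simp only: Jt orth)
    then have "transpose (Jt w) *v (p - stack x) = 0" using inner_eq_zero_iff by blast
    moreover have "ft w - stack x = (ft w - p) + (p - stack x)" by simp
    ultimately show ?thesis by (simp only: matrix_vector_right_distrib add_0_right)
  qed
  have pyth: "norm (ft w - stack x) ^ 2 = norm (ft w - p) ^ 2 + norm (p - stack x) ^ 2" for w
  proof -
    have "orthogonal (ft w - p) (p - stack x)"
      unfolding orthogonal_def ftp by (rule orth[of "\<lambda>k. net A \<phi> (vec_to_mat w) (\<mu> k) - m k"])
    then show ?thesis using norm_add_Pythagorean by fastforce
  qed

  \<comment> \<open>Convergence of the reference descent\<close>
  have Rh0: "0 \<le> Rh0"
    using eps_c eps_o rho_pos by (simp add: Rh0_def Rt0_def)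
  have init: "norm (ft w0 - stack x) \<le> Rh0"
  proof -
    have "ft w0 - stack x = (net_stack A \<phi> W0 xt - stack xt) - stack \<xi> - stack out"
      by (simp add: ft_def w0_def stack_diff net_stack_def x_def algebra_simps)
    moreover have "norm (stack \<xi>) \<le> sqrt (real CARD('n)) * \<epsilon>c"
      using within_cluster by (intro norm_stack_le) auto
    moreover have "norm (a - b - c) \<le> norm a + norm b + norm c" for a b c :: "real ^ ('n \<times> 'p)"
      by norm
    ultimately show ?thesis
      using nout unfolding Rh0_def Rt0_def by (smt (verit))
  qed
  have init_p: "norm (ft w0 - p) \<le> Rh0"
  proof -
    have "norm (ft w0 - p) ^ 2 \<le> norm (ft w0 - stack x) ^ 2" by (simp add: pyth)
    from power2_le_imp_le[OF this] show ?thesis using init by simp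
  qed

  \<comment> \<open>Both Jacobian bounds at \<open>W0\<close> and one unit vector give the ordering
    of \<open>\<alpha>c\<close> and \<open>\<beta>c\<close>.\<close>
  have ab: "0 < \<alpha>" "\<alpha> \<le> \<beta>"
  proof -
    have "W0 \<in> D" using Rloc_pos by (simp add: D_def)
    then have "\<alpha>c \<le> \<beta>c"
      using Jc_bounds[rule_format, of W0 "axis undefined 1"] by simp
    then show "\<alpha> \<le> \<beta>"
      unfolding \<alpha>_def \<beta>_def using n1 n2 Jc_consts_pos by (intro mult_mono) auto
    show "0 < \<alpha>" using n1 Jc_consts_pos by (simp add: \<alpha>_def)
  qed
  have L0: "0 < L" using n1 n2 Jc_consts_pos by (simp add: L_def)
  have step1: "8 * \<eta> * \<beta> ^ 4 \<le> \<alpha> ^ 2"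
    using step_size(2) ab by (simp add: pos_le_divide_eq mult_ac)
  have step2: "2 * \<eta> * L * \<beta> ^ 2 * Rh0 \<le> \<alpha> ^ 2"
  \<comment> \<open>Clearing the denominator needs \<open>Rh0\<close> nonzero; at zero the left side
    vanishes.\<close>
  proof (cases "Rh0 = 0")
    case False
    then show ?thesis using step_size(2) ab L0 Rh0 by (simp add: pos_le_divide_eq mult_ac)
  qed simp
  note gd = gradient_descent_linear_convergence[where R = Rloc and u = u, OF der pl upper lip init_p ab
      less_imp_le[OF L0] less_imp_le[OF step_size(1)] step1 step2 radius u(1) u(2)[unfolded grad]]
  have conv: "norm (ft (u \<tau>) - p) \<le> (1 - \<eta> * \<alpha> ^ 2 / 2) ^ \<tau> * norm (ft w0 - p)"
    and near: "norm (u \<tau> - w0) \<le> 2 * \<beta> / \<alpha> ^ 2 * Rh0" for \<tau>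
    by (rule gd; assumption)+
  let ?c = "\<eta> * \<alpha> ^ 2 / 2"
  have c: "0 < ?c" using step_size ab by simp
  have c1: "?c \<le> 1" using step_size_le[OF less_imp_le[OF step_size(1)] ab step1] by linarith
  \<comment> \<open>By Pythagoras the residual against the noisy targets does not exceed its initial
    size: the part against \<open>p\<close> decays and the other is constant.\<close>
  have res: "norm (ft (u \<tau>) - stack x) \<le> Rh0" for \<tau>
  proof -
    have "(1 - ?c) ^ \<tau> * norm (ft w0 - p) \<le> norm (ft w0 - p)"
      using c c1 by (intro mult_left_le_one_le zero_le_power power_le_one) auto
    then have "norm (ft (u \<tau>) - p) ^ 2 \<le> norm (ft w0 - p) ^ 2"
      using conv[of \<tau>] by (intro power_mono) auto
    then have "norm (ft (u \<tau>) - stack x) ^ 2 \<le> norm (ft w0 - stack x) ^ 2" by (simp add: pyth)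
    from power2_le_imp_le[OF this] show ?thesis using init by simp
  qed
  have fit: "norm (ft (u T) - p) \<le> \<nu>"
  proof -
    have "(1 - ?c) ^ T * Rh0 \<le> \<nu>"
      using T_large eps_pos by (intro geometric_decay_le c c1 Rh0) (auto simp: Tstar_def \<nu>_def)
    moreover have "(1 - ?c) ^ T * norm (ft w0 - p) \<le> (1 - ?c) ^ T * Rh0"
      using c1 init_p by (intro mult_left_mono) auto
    ultimately show ?thesis using conv[of T] by linarith
  qed

  \<comment> \<open>Comparison of the actual path with the reference path\<close>
  have \<Delta>0: "0 \<le> \<Delta>f" "0 \<le> \<Delta>J"
    using op_norm_nonneg[of A] B RW0 R\<mu>0 eps_c eps_o by (simp_all add: \<Delta>f_def \<Delta>J_def)
  have dnet: "norm (net A \<phi> V (x i) - net A \<phi> V (xt i)) \<le> \<Delta>f" if "V \<in> D" for V i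
  proof -
    have "op_norm A * B1 * norm V * norm (x i - xt i) \<le> \<Delta>f"
      unfolding \<Delta>f_def using op_norm_nonneg[of A] B RW0 RW[OF that] xxt
      by (intro mult_mono) auto
    then show ?thesis by (rule order_trans[OF norm_net_diff_le[OF \<phi>'(1,3)]])
  qed
  \<comment> \<open>Stacking the per-sample errors costs the square root of the sample count, which
    is the extra factor in \<gamma>.\<close>
  have df: "norm (f w - ft w) \<le> sqrt (real CARD('n)) * \<Delta>f" if "w \<in> cball w0 Rloc" for w
    unfolding f_def ft_def net_stack_def stack_diff by (intro norm_stack_le dnet D that)
  have dJ: "norm (JX w *v h - Jt w *v h) \<le> \<Delta>J * norm h" if "w \<in> cball w0 Rloc" for w h
  proof -
    let ?V = "vec_to_mat w" and ?H = "vec_to_mat h"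
    let ?C = "op_norm A * (B1 + B2 * RW * R\<mu>) * (\<epsilon>c + \<epsilon>o) * norm h"
    have "norm (dnet A \<phi> ?V (x i) ?H - dnet A \<phi> ?V (xt i) ?H) \<le> ?C" for i
    proof -
      have "norm (dnet A \<phi> ?V (x i) ?H - dnet A \<phi> ?V (xt i) ?H)
          \<le> op_norm A * (B1 + B2 * norm ?V * norm (xt i)) * norm (x i - xt i) * norm ?H"
        by (rule norm_dnet_diff_le) (rule \<phi>')+
      also have "\<dots> \<le> op_norm A * (B1 + B2 * RW * R\<mu>) * (\<epsilon>c + \<epsilon>o) * norm ?H"
        using op_norm_nonneg[of A] B RW0 R\<mu>0 RW[OF D[OF that]] R\<mu>[of "g i"] xxt[of i]
        by (intro mult_right_mono mult_mono mult_left_mono add_left_mono add_nonneg_nonneg mult_nonneg_nonneg)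
          (auto simp: xt_def)
      finally show ?thesis by simp
    qed
    then have "norm (JX w *v h - Jt w *v h) \<le> sqrt (real CARD('n)) * ?C"
      unfolding JX_def J_def Jt_def net_jacobian_works(2)[OF \<phi>'(1)] stack_diff by (rule norm_stack_le)
    then show ?thesis by (simp add: \<Delta>J_def mult.assoc)
  qed
  have w: "mat_to_vec (W 0) = w0" "mat_to_vec (W (Suc \<tau>)) = mat_to_vec (W \<tau>)
      - \<eta> *\<^sub>R (transpose (JX (mat_to_vec (W \<tau>))) *v (f (mat_to_vec (W \<tau>)) - stack x))" for \<tau>
    using gd_step by (simp_all add: gd_init w0_def JX_def f_def)
  have path: "\<eta> * (\<Delta>J * Rh0 + (\<beta> + \<Delta>J) * (sqrt (real CARD('n)) * \<Delta>f)) * real T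
      * exp (\<eta> * (L * Rh0 + \<beta> * (\<beta> + \<Delta>J)) * real T) = \<Delta>path T"
    by (simp add: \<Delta>path_def \<gamma>_def \<kappa>_def \<beta>X_def mult.assoc)
  have "\<beta> \<ge> 0" using ab by simp
  have "0 \<le> sqrt (real CARD('n)) * \<Delta>f" using \<Delta>0 by simp
  note pert = gradient_descent_perturbation[where R = Rloc and w = "\<lambda>\<tau>. mat_to_vec (W \<tau>)" and u = u and T = T,
      OF der upper lip dJ df \<open>\<beta> \<ge> 0\<close> less_imp_le[OF L0] less_imp_le[OF step_size(1)] \<Delta>0(2) this Rh0 u w near res,
      unfolded path]
  have wT: "norm (mat_to_vec (W T) - u T) \<le> \<Delta>path T" "mat_to_vec (W T) \<in> cball w0 Rloc"
    using pert(1)[OF _ _ _ _ _ path_small order_refl, unfolded path] pert(2)[OF _ _ _ _ _ path_small order_refl] by auto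
  have uT: "u T \<in> cball w0 Rloc"
    using near[of T] radius by (simp add: dist_norm norm_minus_commute)
  have ftd: "norm (ft (mat_to_vec (W T)) - ft (u T)) \<le> \<beta> * \<Delta>path T"
  proof -
    have "norm (ft (mat_to_vec (W T)) - ft (u T)) \<le> \<beta> * norm (mat_to_vec (W T) - u T)"
    proof (rule differentiable_bound[OF convex_cball[of w0 Rloc] _ _ wT(2) uT])
      show "(ft has_derivative (*v) (Jt v)) (at v within cball w0 Rloc)" for v
        by (rule has_derivative_at_withinI[OF der])
      show "op_norm (Jt v) \<le> \<beta>" if "v \<in> cball w0 Rloc" for v
        by (rule onorm_le) (use upper[OF that] in simp)
    qed
    then show ?thesis using mult_left_mono[OF wT(1) \<open>\<beta> \<ge> 0\<close>] by linarith
  qed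

  \<comment> \<open>Error at each sample and recovery of the clusters\<close>
  have bound: "norm (net A \<phi> (W T) (x i) - \<mu> (g i)) \<le> \<zeta> T + 2 * \<nu>" for i
  proof -
    have 1: "norm (net A \<phi> (W T) (x i) - net A \<phi> (W T) (xt i)) \<le> \<Delta>f"
      using dnet D[OF wT(2)] by simp
    have 2: "norm (net A \<phi> (W T) (xt i) - block (ft (u T)) i) \<le> \<beta> * \<Delta>path T"
      using norm_block_le[of "ft (mat_to_vec (W T)) - ft (u T)" i] ftd
      by (simp add: block_diff) (simp add: ft_def net_stack_def)
    have 3: "norm (block (ft (u T)) i - m (g i)) \<le> \<nu>"
      using norm_block_le[of "ft (u T) - p" i] fit by (simp add: block_diff p_def)
    \<comment> \<open>Four errors: noisy input, deviation of the weights, misfit of the reference,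
      and offset of the cluster mean. The last two cost \<nu> each.\<close>
    have "net A \<phi> (W T) (x i) - \<mu> (g i) = (net A \<phi> (W T) (x i) - net A \<phi> (W T) (xt i))
        + (net A \<phi> (W T) (xt i) - block (ft (u T)) i) + (block (ft (u T)) i - m (g i)) + (m (g i) - \<mu> (g i))"
      by simp
    also have "norm \<dots> \<le> \<Delta>f + \<beta> * \<Delta>path T + \<nu> + \<nu>"
      by (intro norm_triangle_mono 1 2 3 mean)
    finally show ?thesis by (simp add: \<zeta>_def)
  qed
  have "norm_2inf (net_stack A \<phi> (W T) x - stack xt) \<le> \<zeta> T + 2 * \<nu>"
    using bound by (auto simp: norm_2inf_def net_stack_def stack_diff xt_def)
  moreover have "{k. is_arg_min (\<lambda>k. norm (net A \<phi> (W T) (x i) - \<mu> k)) (\<lambda>_. True) k} = {g i}" for i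
  proof -
    let ?F = "net A \<phi> (W T) (x i)"
    \<comment> \<open>Centers are more than twice the error bound apart, so by the triangle
      inequality every other center is strictly farther away.\<close>
    have "norm (?F - \<mu> (g i)) < norm (?F - \<mu> k)" if "k \<noteq> g i" for k
    proof -
      have "\<delta> \<le> ereal (norm (\<mu> k - \<mu> (g i)))"
        unfolding \<delta>_def using that by (intro INF_lower2[of "(k, g i)"]) auto
      from less_le_trans[OF separation this] have "2 * (\<zeta> T + 2 * \<nu>) < norm (\<mu> k - \<mu> (g i))"
        by (simp add: \<nu>_def)
      moreover have "norm (\<mu> k - \<mu> (g i)) \<le> norm (?F - \<mu> (g i)) + norm (?F - \<mu> k)"
        by norm
      moreover have "a < b" if "2 * d < c" "c \<le> a + b" "a \<le> d" for a b c d :: real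
        using that by linarith
      ultimately show ?thesis using bound[of i] by blast
    qed
    then show ?thesis by (auto simp: is_arg_min_def) (metis not_less_iff_gr_or_eq)
  qed
  ultimately show ?thesis using bound by (simp add: \<nu>_def)
qed

end
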